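(* (I) Any deterministic algorithm requires $\Omega(n\log n)$ dynamic rank queries to solve the matroid union problem, and likewise to solve the matroid intersection problem. (II) Any deterministic algorithm requires $\Omega(n\log n)$ (traditional) independence queries to solve the matroid union problem, and likewise to solve the matroid intersection problem.
   Context: Matroid intersection: given two matroids $(U,\mathcal{I}_1),(U,\mathcal{I}_2)$ on a common ground set, find a maximum-size set in $\mathcal{I}_1\cap\mathcal{I}_2$. Matroid union: given matroids $(U_i,\mathcal{I}_i)$, $i=1,\dots,k$, find a maximum-size set $S_1\cup\dots\cup S_k$ with $S_i\in\mathcal{I}_i$. $n$ is the (maximum) ground set size. A traditional independence query asks, for an arbitrary $S\subseteq U$, whether $S\in\mathcal{I}$. Dynamic-rank-oracle model: for each matroid, starting from $S_0=\emptyset$ and counter $k=0$, the algorithm may perform $\textsc{Insert}(v,i)$ (create $S_{k+1}:=S_i\cup\{v\}$, increment $k$), $\textsc{Delete}(v,i)$ (create $S_{k+1}:=S_i\setminus\{v\}$, increment $k$), and $\textsc{Query}(i)$ (return the rank of $S_i$), where $i$ may index any previously created set; each operation counts as one query. *)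

theory Defs
  imports Complex_Main
begin

section \<open>Matroids\<close>

type_synonym 'a set_system = "'a set \<times> 'a set set"

abbreviation ground :: "'a set_system \<Rightarrow> 'a set" where
  "ground M \<equiv> fst M"

abbreviation indep :: "'a set_system \<Rightarrow> 'a set set" where
  "indep M \<equiv> snd M"

definition matroid :: "'a set_system \<Rightarrow> bool" where
  "matroid M \<longleftrightarrow>
     finite (ground M) \<and> indep M \<subseteq> Pow (ground M) \<and> {} \<in> indep M \<and>
     (\<forall>S\<in>indep M. \<forall>T. T \<subseteq> S \<longrightarrow> T \<in> indep M) \<and>
     (\<forall>S\<in>indep M. \<forall>T\<in>indep M. card S < card T \<longrightarrow> (\<exists>x\<in>T - S. insert x S \<in> indep M))"

definition matroid_rank :: "'a set_system \<Rightarrow> 'a set \<Rightarrow> nat" where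
  "matroid_rank M S = Max (card ` {T \<in> indep M. T \<subseteq> S})"

section \<open>The two optimization problems\<close>

definition intersection_instance :: "'a set_system list \<Rightarrow> bool" where
  "intersection_instance Ms \<longleftrightarrow>
     (\<exists>M1 M2. Ms = [M1, M2] \<and> matroid M1 \<and> matroid M2 \<and> ground M1 = ground M2)"

definition common_independent_sets :: "'a set_system list \<Rightarrow> 'a set set" where
  "common_independent_sets Ms = {S. \<forall>M\<in>set Ms. S \<in> indep M}"

definition union_instance :: "nat \<Rightarrow> 'a set_system list \<Rightarrow> bool" where
  "union_instance k Ms \<longleftrightarrow> length Ms = k \<and> (\<forall>M\<in>set Ms. matroid M)"

definition unions_of_independent_sets :: "'a set_system list \<Rightarrow> 'a set set" where
  "unions_of_independent_sets Ms =
     {\<Union>j<length Ms. S j | S. \<forall>j<length Ms. S j \<in> indep (Ms ! j)}"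

definition max_size_in :: "'a set set \<Rightarrow> 'a set \<Rightarrow> bool" where
  "max_size_in F S \<longleftrightarrow> S \<in> F \<and> (\<forall>T\<in>F. card T \<le> card S)"

definition max_ground_size :: "'a set_system list \<Rightarrow> nat" where
  "max_ground_size Ms = Max ((\<lambda>M. card (ground M)) ` set Ms)"

section \<open>Deterministic query algorithms\<close>

text \<open>
  A deterministic algorithm is an adaptive decision tree: the next query depends on all answers
  received so far, and computation between queries is free and unrestricted. Well-foundedness of
  the datatype is no loss of generality: there are only finitely many matroids on
  given finite ground sets, and branches that no such matroids can reach may be cut off.
\<close>

datatype ('q, 'r, 'o) query_tree =
    Return 'o
  | Ask 'q "'r \<Rightarrow> ('q, 'r, 'o) query_tree"

text \<open>An oracle consists of an initial state and a transition function, which answers a query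
  and updates the state.\<close>

type_synonym ('s, 'q, 'r) oracle_machine = "'s \<times> ('s \<Rightarrow> 'q \<Rightarrow> 'r \<times> 's)"

primrec run_output ::
    "('q, 'r, 'o) query_tree \<Rightarrow> ('s \<Rightarrow> 'q \<Rightarrow> 'r \<times> 's) \<Rightarrow> 's \<Rightarrow> 'o" where
  "run_output (Return x) step s = x"
| "run_output (Ask q next) step s = run_output (next (fst (step s q))) step (snd (step s q))"

primrec run_queries ::
    "('q, 'r, 'o) query_tree \<Rightarrow> ('s \<Rightarrow> 'q \<Rightarrow> 'r \<times> 's) \<Rightarrow> 's \<Rightarrow> nat" where
  "run_queries (Return x) step s = 0"
| "run_queries (Ask q next) step s =
     Suc (run_queries (next (fst (step s q))) step (snd (step s q)))"

text \<open>The ground sets (hence also the number of matroids) are known to the algorithm; the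
  independent sets are accessible only through the oracle.\<close>

type_synonym ('a, 'q, 'r) algorithm = "'a set list \<Rightarrow> ('q, 'r, 'a set) query_tree"

definition output_on ::
    "('a set_system list \<Rightarrow> ('s, 'q, 'r) oracle_machine) \<Rightarrow> ('a, 'q, 'r) algorithm \<Rightarrow>
     'a set_system list \<Rightarrow> 'a set" where
  "output_on orc A Ms = run_output (A (map fst Ms)) (snd (orc Ms)) (fst (orc Ms))"

definition queries_on ::
    "('a set_system list \<Rightarrow> ('s, 'q, 'r) oracle_machine) \<Rightarrow> ('a, 'q, 'r) algorithm \<Rightarrow>
     'a set_system list \<Rightarrow> nat" where
  "queries_on orc A Ms = run_queries (A (map fst Ms)) (snd (orc Ms)) (fst (orc Ms))"

definition solves ::
    "('a set_system list \<Rightarrow> ('s, 'q, 'r) oracle_machine) \<Rightarrow> ('a set_system list \<Rightarrow> bool) \<Rightarrow>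
     ('a set_system list \<Rightarrow> 'a set set) \<Rightarrow> ('a, 'q, 'r) algorithm \<Rightarrow> bool" where
  "solves orc inst feasible A \<longleftrightarrow>
     (\<forall>Ms. inst Ms \<longrightarrow> max_size_in (feasible Ms) (output_on orc A Ms))"

definition requires_queries ::
    "('a set_system list \<Rightarrow> ('s, 'q, 'r) oracle_machine) \<Rightarrow> ('a set_system list \<Rightarrow> bool) \<Rightarrow>
     ('a set_system list \<Rightarrow> 'a set set) \<Rightarrow> nat \<Rightarrow> real \<Rightarrow> bool" where
  "requires_queries orc inst feasible n b \<longleftrightarrow>
     (\<forall>A. solves orc inst feasible A \<longrightarrow>
        (\<exists>Ms. inst Ms \<and> max_ground_size Ms = n \<and> b \<le> real (queries_on orc A Ms)))"

section \<open>The oracle models\<close>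

text \<open>In both models the first component of a query selects the matroid. Illegal queries (to a
  nonexistent matroid or set, or inserting a non-element) are counted, but have no effect and
  return a fixed answer, so they reveal nothing about the independent sets.\<close>

definition independence_oracle ::
    "'a set_system list \<Rightarrow> (unit, nat \<times> 'a set, bool) oracle_machine" where
  "independence_oracle Ms =
     ((), \<lambda>_ (j, S). (j < length Ms \<and> S \<in> indep (Ms ! j), ()))"

datatype 'a dynamic_op =
    Insert nat 'a nat
  | Delete nat 'a nat
  | Query nat nat

text \<open>The state maps each matroid index to the list of the sets created so far for that matroid,
  so that \<open>\<sigma> j ! i\<close> is the set \<open>S\<^sub>i\<close> of the matroid with index \<open>j\<close>.\<close>

fun dynamic_rank_step ::
    "'a set_system list \<Rightarrow> (nat \<Rightarrow> 'a set list) \<Rightarrow> 'a dynamic_op \<Rightarrow>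
     nat option \<times> (nat \<Rightarrow> 'a set list)" where
  "dynamic_rank_step Ms \<sigma> (Insert j v i) =
     (None, if j < length Ms \<and> i < length (\<sigma> j) \<and> v \<in> ground (Ms ! j)
            then \<sigma>(j := \<sigma> j @ [\<sigma> j ! i \<union> {v}]) else \<sigma>)"
| "dynamic_rank_step Ms \<sigma> (Delete j v i) =
     (None, if j < length Ms \<and> i < length (\<sigma> j)
            then \<sigma>(j := \<sigma> j @ [\<sigma> j ! i - {v}]) else \<sigma>)"
| "dynamic_rank_step Ms \<sigma> (Query j i) =
     (if j < length Ms \<and> i < length (\<sigma> j)
      then Some (matroid_rank (Ms ! j) (\<sigma> j ! i)) else None, \<sigma>)"

definition dynamic_rank_oracle ::
    "'a set_system list \<Rightarrow> (nat \<Rightarrow> 'a set list, 'a dynamic_op, nat option) oracle_machine" where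
  "dynamic_rank_oracle Ms = (\<lambda>_. [{}], dynamic_rank_step Ms)"

end

theory Submission
  imports Defs "HOL-Library.FuncSet" "HOL-Real_Asymp.Real_Asymp"
begin

text \<open>
  Hide one partition \<open>f\<close> of a vertex set in the first matroid and another one \<open>h\<close> in the second, so
  that the optimum reveals whether two fixed vertices \<open>0\<close> and \<open>1\<close> are connected in the join of the
  partitions. Every query reveals at most one bit about one of the matroids, hence the set of pairs
  \<open>(f, h)\<close> producing a given sequence of bits is a combinatorial rectangle, and the number of
  sequences is at least the rank of the 0/1 matrix ``\<open>0\<close> and \<open>1\<close> are not connected by \<open>f\<close> and \<open>h\<close>''.

  For a set \<open>T\<close> of vertices let \<open>[f, h, T]\<close> indicate that no two elements of \<open>T\<close> are connected, and
  let \<open>f\<^sub>u\<close> arise from \<open>f\<close> by merging the class of \<open>a \<notin> T\<close> into that of \<open>u \<in> T\<close>. Then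
  \<open>(|T| - 1) [f, h, T \<union> {a}] = (\<Sum>u\<in>T. [f\<^sub>u, h, T]) - [f, h, T]\<close>. Starting from \<open>T = {0, 1}\<close>, the row
  space thus contains all rows \<open>[f, \<cdot>, T]\<close> with \<open>{0, 1} \<subseteq> T\<close>. If \<open>T\<close> is a set of \<open>m\<close>
  vertices and \<open>f\<close>, \<open>h\<close> are retractions onto \<open>T\<close>, then \<open>[f, h, T] = 1\<close> only for \<open>f = h\<close>, so the rank
  is at least the number \<open>m\<^sup>m\<close> of retractions of \<open>2m\<close> vertices onto \<open>T\<close>.
\<close>

section \<open>Linear algebra: rank against the number of rectangles\<close>

section \<open>Rank bound for partitions into rectangles\<close>

text \<open>Gaussian elimination, one equation at a time: an equation with a nonzero coefficient at
  \<open>g\<close> is solved for the unknown \<open>g\<close> and substituted into the others, which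
  costs one equation and one unknown.\<close>

lemma homogeneous_system_nontrivial:
  fixes b :: "'t \<Rightarrow> 'h \<Rightarrow> real"
  assumes "finite T" "finite H" "card T < card H"
  shows "\<exists>w. (\<exists>h\<in>H. w h \<noteq> 0) \<and> (\<forall>t\<in>T. (\<Sum>h\<in>H. w h * b t h) = 0)"
  using assms
proof (induction T arbitrary: H b rule: finite_induct)
  case empty
  then obtain h where "h \<in> H" by fastforce
  then show ?case by (intro exI[of _ "\<lambda>_. 1"]) auto
next
  case (insert u T)
  show ?case
  proof (cases "\<forall>h\<in>H. b u h = 0")
    case True
    obtain w where w: "\<exists>h\<in>H. w h \<noteq> 0" "\<forall>t\<in>T. (\<Sum>h\<in>H. w h * b t h) = 0"
      using insert.IH[of H b] insert.prems insert.hyps by auto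
    show ?thesis using w True by (intro exI[of _ w]) auto
  next
    case False
    then obtain g where g: "g \<in> H" "b u g \<noteq> 0" by blast
    let ?H = "H - {g}"
    have "card T < card ?H" using insert.prems insert.hyps g by simp
    then obtain w where w: "\<exists>h\<in>?H. w h \<noteq> 0"
      "\<forall>t\<in>T. (\<Sum>h\<in>?H. w h * (b t h - b t g * b u h / b u g)) = 0"
      using insert.IH[of ?H "\<lambda>t h. b t h - b t g * b u h / b u g"] insert.prems by auto
    \<comment> \<open>\<open>- s\<close> is the value that equation \<open>u\<close> forces on the
      unknown \<open>g\<close> once all other unknowns are chosen.\<close>
    define s where "s = (\<Sum>h\<in>?H. w h * b u h) / b u g"
    define w' where "w' = w(g := - s)"
    have expand: "(\<Sum>h\<in>H. w' h * b t h) = (\<Sum>h\<in>?H. w h * b t h) - s * b t g" for t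
    proof -
      have "(\<Sum>h\<in>H. w' h * b t h) = w' g * b t g + (\<Sum>h\<in>?H. w' h * b t h)"
        using g insert.prems by (simp add: sum.remove)
      moreover have "(\<Sum>h\<in>?H. w' h * b t h) = (\<Sum>h\<in>?H. w h * b t h)"
        by (rule sum.cong) (auto simp: w'_def)
      ultimately show ?thesis by (simp add: w'_def)
    qed
    have "(\<Sum>h\<in>H. w' h * b t h) = 0" if "t \<in> T" for t
    proof -
      have "(\<Sum>h\<in>?H. w h * (b t h - b t g * b u h / b u g)) =
          (\<Sum>h\<in>?H. w h * b t h) - (\<Sum>h\<in>?H. (w h * b u h) * (b t g / b u g))"
        by (simp add: sum_subtractf[symmetric] algebra_simps)
      also have "(\<Sum>h\<in>?H. (w h * b u h) * (b t g / b u g)) = s * b t g"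
        by (subst sum_distrib_right[symmetric]) (simp add: s_def)
      finally show ?thesis using w(2) that expand[of t] by auto
    qed
    moreover have "(\<Sum>h\<in>H. w' h * b u h) = 0"
      using g by (simp add: expand s_def)
    moreover have "\<exists>h\<in>H. w' h \<noteq> 0" using w(1) by (auto simp: w'_def)
    ultimately show ?thesis by (intro exI[of _ w']) auto
  qed
qed

text \<open>The colours \<tau> cut the matrix \<open>N\<close> into rectangles on which it is
  constant, so \<open>N\<close> is a sum of \<open>card T\<close> matrices of rank one. With more
  columns than colours, some nonzero \<open>w\<close> is orthogonal to the column indicator of every
  rectangle, hence to every row of \<open>N\<close>, against the independence of the
  columns.\<close>

lemma rectangle_partition_card_ge:
  fixes N :: "'f \<Rightarrow> 'h \<Rightarrow> real" and \<tau> :: "'f \<Rightarrow> 'h \<Rightarrow> 't"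
  assumes "finite T" "finite H"
    and range: "\<And>f h. f \<in> F \<Longrightarrow> h \<in> H \<Longrightarrow> \<tau> f h \<in> T"
    and rectangle: "\<And>f h f' h'. f \<in> F \<Longrightarrow> h \<in> H \<Longrightarrow> f' \<in> F \<Longrightarrow> h' \<in> H \<Longrightarrow>
      \<tau> f h = \<tau> f' h' \<Longrightarrow> \<tau> f h' = \<tau> f h"
    and const: "\<And>f h f' h'. f \<in> F \<Longrightarrow> h \<in> H \<Longrightarrow> f' \<in> F \<Longrightarrow> h' \<in> H \<Longrightarrow>
      \<tau> f h = \<tau> f' h' \<Longrightarrow> N f h = N f' h'"
    and independent: "\<And>w. (\<And>f. f \<in> F \<Longrightarrow> (\<Sum>h\<in>H. w h * N f h) = 0) \<Longrightarrow> \<forall>h\<in>H. w h = 0"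
  shows "card H \<le> card T"
proof (rule ccontr)
  assume "\<not> card H \<le> card T"
  define b where "b t h = (of_bool (\<exists>f\<in>F. \<tau> f h = t) :: real)" for t h
  obtain w where w: "\<exists>h\<in>H. w h \<noteq> 0" "\<forall>t\<in>T. (\<Sum>h\<in>H. w h * b t h) = 0"
    using homogeneous_system_nontrivial[OF assms(1,2), of b] \<open>\<not> card H \<le> card T\<close> by auto
  \<comment> \<open>The common value of \<open>N\<close> on the part of rectangle \<open>t\<close>
    in row \<open>f\<close>; which column is chosen does not matter by \<open>const\<close>.\<close>
  define v where "v f t = (if \<exists>h\<in>H. \<tau> f h = t then N f (SOME h. h \<in> H \<and> \<tau> f h = t) else 0)" for f t
  have decomp: "N f h = (\<Sum>t\<in>T. v f t * b t h)" if fh: "f \<in> F" "h \<in> H" for f h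
  proof -
    have "v f t * b t h = (if t = \<tau> f h then N f h else 0)" for t
    proof (cases "t = \<tau> f h")
      case True
      define g where "g = (SOME h'. h' \<in> H \<and> \<tau> f h' = t)"
      have "g \<in> H \<and> \<tau> f g = t"
        unfolding g_def by (rule someI[of _ h]) (use fh True in auto)
      then have "N f g = N f h" using const[of f g f h] fh True by simp
      then show ?thesis using fh True by (auto simp: v_def b_def g_def)
    next
      case False
      \<comment> \<open>If row \<open>f\<close> and column \<open>h\<close> both meet the rectangle
        of \<open>t\<close>, then their crossing belongs to it and has colour
        \<open>t\<close>.\<close>
      have "\<not> ((\<exists>h'\<in>H. \<tau> f h' = t) \<and> (\<exists>f'\<in>F. \<tau> f' h = t))"
      proof
        assume "(\<exists>h'\<in>H. \<tau> f h' = t) \<and> (\<exists>f'\<in>F. \<tau> f' h = t)"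
        then obtain h' f' where "h' \<in> H" "f' \<in> F" "\<tau> f h' = t" "\<tau> f' h = t" by blast
        then show False using rectangle[of f h' f' h] False fh by simp
      qed
      then show ?thesis using False by (auto simp: v_def b_def)
    qed
    then show ?thesis using assms(1) range[OF fh] by simp
  qed
  have "(\<Sum>h\<in>H. w h * N f h) = 0" if "f \<in> F" for f
  proof -
    have "(\<Sum>h\<in>H. w h * N f h) = (\<Sum>h\<in>H. \<Sum>t\<in>T. v f t * (w h * b t h))"
      using that by (simp add: decomp sum_distrib_left mult_ac)
    also have "\<dots> = (\<Sum>t\<in>T. v f t * (\<Sum>h\<in>H. w h * b t h))"
      by (subst sum.swap) (simp add: sum_distrib_left)
    finally show ?thesis using w(2) by simp
  qed
  then show False using independent w(1) by blast
qed

section \<open>Connectivity in the join of two partitions\<close>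

section \<open>The connectivity matrix\<close>

text \<open>A partition is given by the fibres of a map. Staying in a fibre of \<open>f\<close> or
  of \<open>h\<close> is a symmetric relation, so its reflexive transitive closure is the join of
  the two equivalence relations.\<close>

definition conn :: "('v \<Rightarrow> 'c) \<Rightarrow> ('v \<Rightarrow> 'd) \<Rightarrow> ('v \<times> 'v) set" where
  "conn f h = {(x, y). f x = f y \<or> h x = h y}\<^sup>*"

definition separated :: "('v \<Rightarrow> 'c) \<Rightarrow> ('v \<Rightarrow> 'd) \<Rightarrow> 'v set \<Rightarrow> bool" where
  "separated f h T \<longleftrightarrow> (\<forall>x\<in>T. \<forall>y\<in>T. (x, y) \<in> conn f h \<longrightarrow> x = y)"

definition merge :: "('v \<Rightarrow> 'c) \<Rightarrow> 'v \<Rightarrow> 'v \<Rightarrow> 'v \<Rightarrow> 'c" where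
  "merge f a u x = (if f x = f a then f u else f x)"

lemma conn_refl [simp]: "(x, x) \<in> conn f h"
  by (simp add: conn_def)

lemma conn_sym:
  assumes "(x, y) \<in> conn f h"
  shows "(y, x) \<in> conn f h"
proof -
  have "sym (conn f h)" unfolding conn_def by (rule sym_rtrancl) (auto intro: symI)
  then show ?thesis using assms by (rule symD)
qed

lemma conn_trans: "(x, y) \<in> conn f h \<Longrightarrow> (y, z) \<in> conn f h \<Longrightarrow> (x, z) \<in> conn f h"
  unfolding conn_def by (rule rtrancl_trans)

lemma connI: "f x = f y \<or> h x = h y \<Longrightarrow> (x, y) \<in> conn f h"
  unfolding conn_def by auto

text \<open>Merging acts on the join like one new edge between \<open>a\<close> and
  \<open>u\<close>, and a path needs that edge at most once, in one of its two directions.\<close>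

lemma conn_merge_iff:
  "(x, y) \<in> conn (merge f a u) h \<longleftrightarrow> (x, y) \<in> conn f h \<or>
     (x, a) \<in> conn f h \<and> (u, y) \<in> conn f h \<or> (x, u) \<in> conn f h \<and> (a, y) \<in> conn f h"
  (is "?L \<longleftrightarrow> ?R x y")
proof
  assume ?L
  then show "?R x y" unfolding conn_def[of "merge f a u"]
  proof (induction rule: rtrancl_induct)
    case base
    show ?case by simp
  next
    case (step y z)
    have "(y, z) \<in> conn f h \<or> f y = f a \<and> f u = f z \<or> f y = f u \<and> f a = f z"
      using step.hyps(2) by (auto simp: merge_def intro: connI split: if_splits)
    then have "?R y z" by (meson connI)
    then show ?case using step.IH by (meson conn_sym conn_trans)
  qed
next
  have sub: "(p, q) \<in> conn f h \<Longrightarrow> (p, q) \<in> conn (merge f a u) h" for p q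
    unfolding conn_def by (erule rtrancl_mono[THEN subsetD, rotated]) (auto simp: merge_def)
  moreover have "(a, u) \<in> conn (merge f a u) h" by (rule connI) (simp add: merge_def)
  moreover assume "?R x y"
  ultimately show ?L by (meson conn_sym conn_trans)
qed

text \<open>If \<open>T\<close> is not separated, all terms vanish. If \<open>a\<close> is connected
  to some \<open>v\<close> in \<open>T\<close>, only the merge with \<open>u = v\<close> keeps
  \<open>T\<close> separated, and the right side is 1 - 1. Otherwise every merge keeps
  \<open>T\<close> separated, and the right side is \<open>card T - 1\<close>.\<close>

lemma separated_insert_eq:
  assumes "finite T" "a \<notin> T"
  shows "(real (card T) - 1) * of_bool (separated f h (insert a T)) =
    (\<Sum>u\<in>T. of_bool (separated (merge f a u) h T)) - of_bool (separated f h T)"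
proof (cases "separated f h T")
  case False
  then have "\<not> separated (merge f a u) h T" "\<not> separated f h (insert a T)" for u
    unfolding separated_def conn_merge_iff by blast+
  then show ?thesis using False by simp
next
  case sep: True
  show ?thesis
  proof (cases "\<exists>v\<in>T. (a, v) \<in> conn f h")
    case True
    then obtain v where v: "v \<in> T" "(a, v) \<in> conn f h" by blast
    have "separated (merge f a u) h T \<longleftrightarrow> u = v" if "u \<in> T" for u
    proof
      assume "separated (merge f a u) h T"
      moreover have "(v, u) \<in> conn (merge f a u) h"
        using v(2) by (simp add: conn_merge_iff conn_sym)
      ultimately show "u = v" using v(1) that unfolding separated_def by metis
    next
      assume "u = v"
      then show "separated (merge f a u) h T"
        using sep v unfolding separated_def conn_merge_iff by (meson conn_sym conn_trans)
    qed
    then have "(\<Sum>u\<in>T. of_bool (separated (merge f a u) h T)) =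
        (\<Sum>u\<in>T. if u = v then 1 else (0 :: real))"
      by (intro sum.cong) auto
    moreover have "\<not> separated f h (insert a T)"
      using v assms(2) unfolding separated_def by auto
    ultimately show ?thesis using sep v(1) assms(1) by simp
  next
    case False
    then have "separated (merge f a u) h T" for u
      using sep unfolding separated_def conn_merge_iff by (meson conn_sym)
    moreover have "separated f h (insert a T)"
      using sep False unfolding separated_def by (metis conn_sym insert_iff)
    ultimately show ?thesis using sep by simp
  qed
qed

text \<open>A linear relation between columns passes from \<open>T0\<close> to larger sets, one
  vertex at a time: the row of \<open>insert a T\<close> is a combination of rows of
  \<open>T\<close>, and these belong to maps in \<open>F\<close> because \<open>F\<close> is closed
  under merging.\<close>

lemma separated_combination_zero:
  fixes w :: "('v \<Rightarrow> 'd) \<Rightarrow> real"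
  assumes closed: "\<And>f a u. f \<in> F \<Longrightarrow> a \<in> V \<Longrightarrow> u \<in> V \<Longrightarrow> merge f a u \<in> F"
    and zero: "\<And>f. f \<in> F \<Longrightarrow> (\<Sum>h\<in>H. w h * of_bool (separated f h T0)) = 0"
    and T0: "finite T0" "T0 \<subseteq> V" "2 \<le> card T0"
    and D: "finite D" "D \<subseteq> V" "D \<inter> T0 = {}"
    and f: "f \<in> F"
  shows "(\<Sum>h\<in>H. w h * of_bool (separated f h (T0 \<union> D))) = 0"
  using D f
proof (induction D arbitrary: f rule: finite_induct)
  case empty
  then show ?case using zero by simp
next
  case (insert a D)
  let ?T = "T0 \<union> D"
  have fin: "finite ?T" "a \<notin> ?T" using insert T0 by auto
  \<comment> \<open>This makes the factor \<open>card ?T - 1\<close> nonzero, so that it can be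
    cancelled at the end.\<close>
  have card: "2 \<le> card ?T" using T0(3) card_mono[of ?T T0] fin by simp
  have "(real (card ?T) - 1) * (\<Sum>h\<in>H. w h * of_bool (separated f h (insert a ?T))) =
      (\<Sum>h\<in>H. w h * ((real (card ?T) - 1) * of_bool (separated f h (insert a ?T))))"
    by (simp add: sum_distrib_left mult_ac)
  also have "\<dots> = (\<Sum>h\<in>H. w h * (\<Sum>u\<in>?T. of_bool (separated (merge f a u) h ?T))) -
      (\<Sum>h\<in>H. w h * of_bool (separated f h ?T))"
    by (simp only: separated_insert_eq[OF fin] right_diff_distrib sum_subtractf)
  also have "(\<Sum>h\<in>H. w h * (\<Sum>u\<in>?T. of_bool (separated (merge f a u) h ?T))) =
      (\<Sum>u\<in>?T. \<Sum>h\<in>H. w h * of_bool (separated (merge f a u) h ?T))"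
    by (subst sum.swap) (simp add: sum_distrib_left)
  also have "\<dots> = 0"
  proof (rule sum.neutral, rule ballI)
    fix u assume "u \<in> ?T"
    then have "merge f a u \<in> F" using closed insert.prems T0(2) by auto
    then show "(\<Sum>h\<in>H. w h * of_bool (separated (merge f a u) h ?T)) = 0"
      using insert.IH insert.prems by auto
  qed
  also have "(\<Sum>h\<in>H. w h * of_bool (separated f h ?T)) = 0"
    using insert.IH insert.prems by auto
  finally show ?case using card by simp
qed

section \<open>The rows and the independent columns of the matrix\<close>

definition vertex_maps :: "nat \<Rightarrow> (nat \<Rightarrow> nat) set" where
  "vertex_maps m = {f. (\<forall>v<2 * m. f v < 2 * m) \<and> (\<forall>v\<ge>2 * m. f v = v)}"

text \<open>The \<open>m\<close> vertices below \<open>m\<close> stay fixed and the \<open>m\<close>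
  others are sent to them freely. Only the columns are restricted in this way: the rows have to be
  closed under merging, which moves fixed points.\<close>

definition retractions :: "nat \<Rightarrow> (nat \<Rightarrow> nat) set" where
  "retractions m = {h. (\<forall>v<m. h v = v) \<and> (\<forall>v\<in>{m..<2 * m}. h v < m) \<and> (\<forall>v\<ge>2 * m. h v = v)}"

lemma retractions_subset: "retractions m \<subseteq> vertex_maps m"
proof
  fix h assume h: "h \<in> retractions m"
  have "h v < 2 * m" if "v < 2 * m" for v
  proof (cases "v < m")
    case False
    then have "h v < m" using h that by (auto simp: retractions_def)
    then show ?thesis by simp
  qed (use h that in \<open>auto simp: retractions_def\<close>)
  then show "h \<in> vertex_maps m" using h by (auto simp: retractions_def vertex_maps_def)
qed

lemma bij_betw_retractions:
  "bij_betw (\<lambda>h. restrict h {m..<2 * m}) (retractions m) ({m..<2 * m} \<rightarrow>\<^sub>E {..<m})"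
proof (rule bij_betw_byWitness[where f' = "\<lambda>g v. if v \<in> {m..<2 * m} then g v else v"])
  show "\<forall>h\<in>retractions m. (\<lambda>v. if v \<in> {m..<2 * m} then restrict h {m..<2 * m} v else v) = h"
    by (auto simp: retractions_def fun_eq_iff)
qed (auto simp: retractions_def PiE_iff fun_eq_iff extensional_def)

lemma finite_retractions: "finite (retractions m)"
  using bij_betw_finite[OF bij_betw_retractions] by (simp add: finite_PiE)

lemma card_retractions: "card (retractions m) = m ^ m"
  using bij_betw_same_card[OF bij_betw_retractions] by (simp add: card_PiE)

text \<open>Values of a retraction are fixed points of it, so \<open>h v\<close> is connected to
  \<open>v\<close> through \<open>h\<close>, and \<open>v\<close> to \<open>g v\<close> through
  \<open>g\<close>; separation forces the two values to coincide. For \<open>h = g\<close> the join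
  is just the fibre partition of \<open>g\<close>.\<close>

lemma separated_retractions_iff:
  assumes g: "g \<in> retractions m" and h: "h \<in> retractions m"
  shows "separated g h {..<m} \<longleftrightarrow> h = g"
proof
  assume sep: "separated g h {..<m}"
  have "h v = g v" for v
  proof (cases "v \<in> {m..<2 * m}")
    case True
    then have less: "h v < m" "g v < m" using g h by (auto simp: retractions_def)
    then have "h (h v) = h v" "g (g v) = g v" using g h by (auto simp: retractions_def)
    then have "(h v, g v) \<in> conn g h" by (metis connI conn_trans)
    then show ?thesis using sep less by (simp add: separated_def)
  qed (use g h in \<open>auto simp: retractions_def not_less\<close>)
  then show "h = g" by auto
next
  assume "h = g"
  moreover have "trans {(x, y). g x = g y}" "refl {(x, y). g x = g y}"
    by (auto intro: transI refl_onI)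
  ultimately have "conn g h = {(x, y). g x = g y}"
    by (auto simp: conn_def rtrancl_trancl_reflcl trancl_id refl_on_def)
  then show "separated g h {..<m}" using g by (simp add: separated_def retractions_def)
qed

text \<open>After \<open>{0, 1}\<close> is enlarged to \<open>{..<m}\<close>, the rows of
  retractions form an identity matrix, and a vanishing combination shows its own
  coefficients.\<close>

lemma separated_columns_independent:
  fixes w :: "(nat \<Rightarrow> nat) \<Rightarrow> real"
  assumes "2 \<le> m"
    and zero: "\<And>f. f \<in> vertex_maps m \<Longrightarrow>
      (\<Sum>h\<in>retractions m. w h * of_bool (separated f h {0, 1})) = 0"
  shows "\<forall>g\<in>retractions m. w g = 0"
proof
  fix g assume g: "g \<in> retractions m"
  have split: "{0, 1} \<union> {2..<m} = {..<m}" using assms(1) by auto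
  have "(\<Sum>h\<in>retractions m. w h * of_bool (separated g h ({0, 1} \<union> {2..<m}))) = 0"
  proof (rule separated_combination_zero[where F = "vertex_maps m" and V = "{..<2 * m}"])
    show "merge f a u \<in> vertex_maps m"
      if "f \<in> vertex_maps m" "a \<in> {..<2 * m}" "u \<in> {..<2 * m}" for f a u
      using that by (auto simp: vertex_maps_def merge_def)
  qed (use assms g retractions_subset in auto)
  moreover have "(\<Sum>h\<in>retractions m. w h * of_bool (separated g h {..<m})) =
      (\<Sum>h\<in>retractions m. if h = g then w h else 0)"
    by (rule sum.cong) (auto simp: separated_retractions_iff[OF g])
  moreover have "\<dots> = w g" using g finite_retractions by simp
  ultimately show "w g = 0" unfolding split by linarith
qed

section \<open>Matroid rank under one-element changes\<close>

section \<open>Bit transcripts\<close>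

lemma finite_indep_subsets:
  assumes "matroid M"
  shows "finite {T \<in> indep M. T \<subseteq> S}" "{T \<in> indep M. T \<subseteq> S} \<noteq> {}"
proof -
  have "{T \<in> indep M. T \<subseteq> S} \<subseteq> Pow (ground M)" "finite (ground M)"
    using assms by (auto simp: matroid_def)
  then show "finite {T \<in> indep M. T \<subseteq> S}" by (meson finite_Pow_iff finite_subset)
  show "{T \<in> indep M. T \<subseteq> S} \<noteq> {}" using assms by (auto simp: matroid_def)
qed

lemma card_le_matroid_rank:
  assumes "matroid M" "T \<in> indep M" "T \<subseteq> S"
  shows "card T \<le> matroid_rank M S"
  unfolding matroid_rank_def using finite_indep_subsets[OF assms(1)] assms by (intro Max_ge) auto

lemma obtain_matroid_rank:
  assumes "matroid M"
  obtains T where "T \<in> indep M" "T \<subseteq> S" "card T = matroid_rank M S"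
proof -
  have "matroid_rank M S \<in> card ` {T \<in> indep M. T \<subseteq> S}"
    unfolding matroid_rank_def using finite_indep_subsets[OF assms] by (intro Max_in) auto
  then show ?thesis using that by auto
qed

lemma matroid_rank_mono:
  assumes "matroid M" "S \<subseteq> S'"
  shows "matroid_rank M S \<le> matroid_rank M S'"
  by (metis assms card_le_matroid_rank obtain_matroid_rank order_trans)

lemma matroid_rank_insert_le:
  assumes "matroid M"
  shows "matroid_rank M (insert v S) \<le> Suc (matroid_rank M S)"
proof -
  obtain T where T: "T \<in> indep M" "T \<subseteq> insert v S" "card T = matroid_rank M (insert v S)"
    using assms by (rule obtain_matroid_rank)
  have "T - {v} \<in> indep M" using assms T(1) unfolding matroid_def by blast
  then have "card (T - {v}) \<le> matroid_rank M S" using assms T(2) by (intro card_le_matroid_rank) auto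
  moreover have "card T \<le> Suc (card (T - {v}))" by (cases "v \<in> T") (auto simp: card_Diff_singleton_if)
  ultimately show ?thesis using T(3) by simp
qed

lemma matroid_rank_empty:
  assumes "matroid M"
  shows "matroid_rank M {} = 0"
  by (metis assms card.empty obtain_matroid_rank subset_empty)

text \<open>Adding an element raises the rank by 0 or 1, so the old rank and the bit "has it
  changed" determine the new rank. Deletion, treated next, is the same in the other
  direction.\<close>

lemma matroid_rank_Un_eq:
  assumes "matroid M" "matroid M'" "matroid_rank M S = matroid_rank M' S"
    and "matroid_rank M (S \<union> {v}) \<noteq> matroid_rank M S \<longleftrightarrow>
      matroid_rank M' (S \<union> {v}) \<noteq> matroid_rank M' S"
  shows "matroid_rank M (S \<union> {v}) = matroid_rank M' (S \<union> {v})"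
proof -
  have "matroid_rank N S \<le> matroid_rank N (S \<union> {v})"
    "matroid_rank N (S \<union> {v}) \<le> Suc (matroid_rank N S)" if "matroid N" for N
    using matroid_rank_mono[OF that, of S "S \<union> {v}"] matroid_rank_insert_le[OF that, of v S] by auto
  from this[OF assms(1)] this[OF assms(2)] show ?thesis using assms(3,4) by linarith
qed

lemma matroid_rank_Diff_eq:
  assumes "matroid M" "matroid M'" "matroid_rank M S = matroid_rank M' S"
    and "matroid_rank M (S - {v}) \<noteq> matroid_rank M S \<longleftrightarrow>
      matroid_rank M' (S - {v}) \<noteq> matroid_rank M' S"
  shows "matroid_rank M (S - {v}) = matroid_rank M' (S - {v})"
proof -
  have "matroid_rank N (S - {v}) \<le> matroid_rank N S"
    "matroid_rank N S \<le> Suc (matroid_rank N (S - {v}))" if "matroid N" for N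
  proof -
    show "matroid_rank N (S - {v}) \<le> matroid_rank N S"
      using that by (rule matroid_rank_mono) auto
    have "matroid_rank N S \<le> matroid_rank N (insert v (S - {v}))"
      using that by (rule matroid_rank_mono) auto
    also have "\<dots> \<le> Suc (matroid_rank N (S - {v}))" using that by (rule matroid_rank_insert_le)
    finally show "matroid_rank N S \<le> Suc (matroid_rank N (S - {v}))" .
  qed
  from this[OF assms(1)] this[OF assms(2)] show ?thesis using assms(3,4) by linarith
qed

section \<open>Runs recorded by one bit per query\<close>

primrec run_bits ::
    "('q, 'r, 'o) query_tree \<Rightarrow> ('s \<Rightarrow> 'q \<Rightarrow> 'r \<times> 's) \<Rightarrow> ('s \<Rightarrow> 'q \<Rightarrow> bool) \<Rightarrow> 's \<Rightarrow> bool list" where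
  "run_bits (Return x) step bt s = []"
| "run_bits (Ask q next) step bt s =
     bt s q # run_bits (next (fst (step s q))) step bt (snd (step s q))"

lemma length_run_bits: "length (run_bits t step bt s) = run_queries t step s"
  by (induction t arbitrary: s) auto

text \<open>By the invariant, equal bits of the first two oracles force all three to give the same
  answer and the same next state. Induction on the tree keeps the three runs on one branch.\<close>

lemma run_bits_paste:
  assumes step: "\<And>s q. I s \<Longrightarrow> bt1 s q = bt2 s q \<Longrightarrow>
      step2 s q = step1 s q \<and> step3 s q = step1 s q \<and> bt3 s q = bt1 s q \<and> I (snd (step1 s q))"
    and "I s" "run_bits t step1 bt1 s = run_bits t step2 bt2 s"
  shows "run_bits t step3 bt3 s = run_bits t step1 bt1 s \<and> run_output t step3 s = run_output t step1 s"
  using assms(2,3)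
proof (induction t arbitrary: s)
  case (Return x)
  then show ?case by simp
next
  case (Ask q nxt)
  then have "bt1 s q = bt2 s q" by simp
  note st = step[OF Ask.prems(1) this]
  then have "run_bits (nxt (fst (step1 s q))) step1 bt1 (snd (step1 s q)) =
      run_bits (nxt (fst (step1 s q))) step2 bt2 (snd (step1 s q))"
    using Ask.prems(2) by simp
  then show ?case using Ask.IH[of "nxt (fst (step1 s q))" "snd (step1 s q)"] st by simp
qed

text \<open>The exchange behind the rectangle property: every matroid of the third list comes from
  the same position of one of the other two. Equal ground sets make an algorithm use the same tree
  on all three lists.\<close>

definition mixture :: "'a set_system list \<Rightarrow> 'a set_system list \<Rightarrow> 'a set_system list \<Rightarrow> bool" where
  "mixture Ms Ms' Ms'' \<longleftrightarrow> (\<forall>M\<in>set Ms \<union> set Ms'. matroid M) \<and>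
     map fst Ms = map fst Ms' \<and> map fst Ms = map fst Ms'' \<and>
     (\<forall>j<length Ms. Ms'' ! j = Ms ! j \<or> Ms'' ! j = Ms' ! j)"

text \<open>All that the lower bound needs from an oracle model: one bit per query, and instances
  with equal bits closed under exchange with a constant output.\<close>

definition bit_transcript ::
    "('a set_system list \<Rightarrow> ('s, 'q, 'r) oracle_machine) \<Rightarrow> ('a, 'q, 'r) algorithm \<Rightarrow>
     ('a set_system list \<Rightarrow> bool list) \<Rightarrow> bool" where
  "bit_transcript orc A enc \<longleftrightarrow>
     (\<forall>Ms. length (enc Ms) = queries_on orc A Ms) \<and>
     (\<forall>Ms Ms' Ms''. mixture Ms Ms' Ms'' \<longrightarrow> enc Ms = enc Ms' \<longrightarrow>
        enc Ms'' = enc Ms \<and> output_on orc A Ms'' = output_on orc A Ms)"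

lemma mixture_length:
  "mixture Ms Ms' Ms'' \<Longrightarrow> length Ms' = length Ms \<and> length Ms'' = length Ms"
  unfolding mixture_def by (metis length_map)

text \<open>The answers themselves serve as bits. A query concerns a single matroid, so a mixture
  answers like one of the two instances, and these agree.\<close>

lemma independence_oracle_transcript: "\<exists>enc. bit_transcript independence_oracle A enc"
proof -
  define bt where "bt Ms s q = fst (snd (independence_oracle Ms) s q)" for Ms :: "'a set_system list" and s q
  define enc where "enc Ms = run_bits (A (map fst Ms)) (snd (independence_oracle Ms)) (bt Ms) ()" for Ms
  have "enc Ms'' = enc Ms \<and> output_on independence_oracle A Ms'' = output_on independence_oracle A Ms"
    if mix: "mixture Ms Ms' Ms''" and eq: "enc Ms = enc Ms'" for Ms Ms' Ms''
  proof -
    note len = mixture_length[OF mix]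
    have fst: "map fst Ms' = map fst Ms" "map fst Ms'' = map fst Ms"
      using mix by (auto simp: mixture_def)
    have "run_bits (A (map fst Ms)) (snd (independence_oracle Ms'')) (bt Ms'') () =
        run_bits (A (map fst Ms)) (snd (independence_oracle Ms)) (bt Ms) () \<and>
        run_output (A (map fst Ms)) (snd (independence_oracle Ms'')) () =
        run_output (A (map fst Ms)) (snd (independence_oracle Ms)) ()"
    proof (rule run_bits_paste[where I = "\<lambda>_. True" and ?bt2.0 = "bt Ms'" and ?step2.0 = "snd (independence_oracle Ms')"])
      fix s and q :: "nat \<times> 'a set"
      assume "bt Ms s q = bt Ms' s q"
      moreover obtain j S where "q = (j, S)" by fastforce
      moreover have "j < length Ms \<Longrightarrow> Ms'' ! j = Ms ! j \<or> Ms'' ! j = Ms' ! j"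
        using mix by (simp add: mixture_def)
      ultimately show "snd (independence_oracle Ms') s q = snd (independence_oracle Ms) s q \<and>
          snd (independence_oracle Ms'') s q = snd (independence_oracle Ms) s q \<and>
          bt Ms'' s q = bt Ms s q \<and> True"
        using len by (auto simp: bt_def independence_oracle_def)
    qed (use eq fst in \<open>auto simp: enc_def\<close>)
    then show ?thesis by (simp add: enc_def output_on_def fst)
  qed
  moreover have "length (enc Ms) = queries_on independence_oracle A Ms" for Ms
    by (simp add: enc_def length_run_bits queries_on_def independence_oracle_def)
  ultimately show ?thesis unfolding bit_transcript_def by blast
qed

text \<open>The rank of a new set differs by at most one from the rank of the set it was created from,
  so one bit per \<open>Insert\<close> or \<open>Delete\<close> determines all answers to rank queries.\<close>

fun rank_change_bit :: "'a set_system list \<Rightarrow> (nat \<Rightarrow> 'a set list) \<Rightarrow> 'a dynamic_op \<Rightarrow> bool" where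
  "rank_change_bit Ms \<sigma> (Insert j v i) \<longleftrightarrow> j < length Ms \<and>
     matroid_rank (Ms ! j) (\<sigma> j ! i \<union> {v}) \<noteq> matroid_rank (Ms ! j) (\<sigma> j ! i)"
| "rank_change_bit Ms \<sigma> (Delete j v i) \<longleftrightarrow> j < length Ms \<and>
     matroid_rank (Ms ! j) (\<sigma> j ! i - {v}) \<noteq> matroid_rank (Ms ! j) (\<sigma> j ! i)"
| "rank_change_bit Ms \<sigma> (Query j i) \<longleftrightarrow> False"

text \<open>The invariant that makes \<open>Query\<close> free of information: the bits seen so far
  already fix the ranks of all created sets.\<close>

definition same_ranks :: "'a set_system list \<Rightarrow> 'a set_system list \<Rightarrow> (nat \<Rightarrow> 'a set list) \<Rightarrow> bool" where
  "same_ranks Ms Ms' \<sigma> \<longleftrightarrow>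
     (\<forall>j<length Ms. \<forall>S\<in>set (\<sigma> j). matroid_rank (Ms ! j) S = matroid_rank (Ms' ! j) S)"

text \<open>Every operation and its bit involve one matroid only, so the mixture behaves like one of
  the instances. For a new set, its bit and the known rank of its predecessor give equal ranks,
  which preserves the invariant.\<close>

lemma dynamic_rank_step_paste:
  assumes mix: "mixture Ms Ms' Ms''" and same: "same_ranks Ms Ms' \<sigma>"
    and bt: "rank_change_bit Ms \<sigma> q = rank_change_bit Ms' \<sigma> q"
  shows "dynamic_rank_step Ms' \<sigma> q = dynamic_rank_step Ms \<sigma> q \<and>
    dynamic_rank_step Ms'' \<sigma> q = dynamic_rank_step Ms \<sigma> q \<and>
    rank_change_bit Ms'' \<sigma> q = rank_change_bit Ms \<sigma> q \<and>
    same_ranks Ms Ms' (snd (dynamic_rank_step Ms \<sigma> q))"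
proof -
  note len = mixture_length[OF mix]
  have pick: "Ms'' ! j = Ms ! j \<or> Ms'' ! j = Ms' ! j" if "j < length Ms" for j
    using mix that by (simp add: mixture_def)
  have grd: "ground (Ms' ! j) = ground (Ms ! j)" "ground (Ms'' ! j) = ground (Ms ! j)"
    if "j < length Ms" for j
    using mix len that unfolding mixture_def by (metis nth_map)+
  have mat: "matroid (Ms ! j)" "matroid (Ms' ! j)" if "j < length Ms" for j
    using mix len that by (auto simp: mixture_def)
  have rk: "matroid_rank (Ms ! j) (\<sigma> j ! i) = matroid_rank (Ms' ! j) (\<sigma> j ! i)"
    if "j < length Ms" "i < length (\<sigma> j)" for i j
    using same that by (simp add: same_ranks_def)
  show ?thesis
  proof (cases q)
    case (Insert j v i)
    have "rank_change_bit Ms'' \<sigma> q = rank_change_bit Ms \<sigma> q"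
      using bt Insert len pick[of j] by auto
    moreover have "same_ranks Ms Ms' (snd (dynamic_rank_step Ms \<sigma> q))"
      using same matroid_rank_Un_eq[OF mat rk, of j i v] bt Insert len
      by (auto simp: same_ranks_def)
    ultimately show ?thesis using Insert len grd by auto
  next
    case (Delete j v i)
    have "rank_change_bit Ms'' \<sigma> q = rank_change_bit Ms \<sigma> q"
      using bt Delete len pick[of j] by auto
    moreover have "same_ranks Ms Ms' (snd (dynamic_rank_step Ms \<sigma> q))"
      using same matroid_rank_Diff_eq[OF mat rk, of j i v] bt Delete len
      by (auto simp: same_ranks_def)
    ultimately show ?thesis using Delete len by auto
  next
    case (Query j i)
    then show ?thesis using same len rk[of j i] pick[of j] by auto
  qed
qed

lemma dynamic_rank_oracle_transcript: "\<exists>enc. bit_transcript dynamic_rank_oracle A enc"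
proof -
  define enc where
    "enc Ms = run_bits (A (map fst Ms)) (dynamic_rank_step Ms) (rank_change_bit Ms) (\<lambda>_. [{}])" for Ms
  have "enc Ms'' = enc Ms \<and> output_on dynamic_rank_oracle A Ms'' = output_on dynamic_rank_oracle A Ms"
    if mix: "mixture Ms Ms' Ms''" and eq: "enc Ms = enc Ms'" for Ms Ms' Ms''
  proof -
    have fst: "map fst Ms' = map fst Ms" "map fst Ms'' = map fst Ms"
      using mix by (auto simp: mixture_def)
    \<comment> \<open>The invariant holds initially because the empty set has rank 0 in every
      matroid.\<close>
    have "same_ranks Ms Ms' (\<lambda>_. [{}])"
      using mix mixture_length[OF mix] by (auto simp: same_ranks_def mixture_def matroid_rank_empty)
    then have "run_bits (A (map fst Ms)) (dynamic_rank_step Ms'') (rank_change_bit Ms'') (\<lambda>_. [{}]) =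
        run_bits (A (map fst Ms)) (dynamic_rank_step Ms) (rank_change_bit Ms) (\<lambda>_. [{}]) \<and>
        run_output (A (map fst Ms)) (dynamic_rank_step Ms'') (\<lambda>_. [{}]) =
        run_output (A (map fst Ms)) (dynamic_rank_step Ms) (\<lambda>_. [{}])"
      using eq fst dynamic_rank_step_paste[OF mix]
      by (intro run_bits_paste[where I = "same_ranks Ms Ms'" and ?bt2.0 = "rank_change_bit Ms'"
            and ?step2.0 = "dynamic_rank_step Ms'"]) (auto simp: enc_def)
    then show ?thesis by (simp add: enc_def output_on_def dynamic_rank_oracle_def fst)
  qed
  moreover have "length (enc Ms) = queries_on dynamic_rank_oracle A Ms" for Ms
    by (simp add: enc_def length_run_bits queries_on_def dynamic_rank_oracle_def)
  ultimately show ?thesis unfolding bit_transcript_def by blast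
qed

section \<open>Partition matroids with capacities\<close>

section \<open>Matroids encoding connectivity\<close>

lemma sum_card_fibres:
  assumes "finite S" "finite C" "k ` S \<subseteq> C"
  shows "(\<Sum>c\<in>C. card {x \<in> S. k x = c}) = card S"
  using sum.group[OF assms, of "\<lambda>_. 1 :: nat"] by simp

definition partition_matroid :: "'a set \<Rightarrow> ('a \<Rightarrow> 'c) \<Rightarrow> ('c \<Rightarrow> nat) \<Rightarrow> 'a set_system" where
  "partition_matroid G k cap = (G, {S. S \<subseteq> G \<and> (\<forall>c. card {x \<in> S. k x = c} \<le> cap c)})"

lemma ground_partition_matroid [simp]: "ground (partition_matroid G k cap) = G"
  by (simp add: partition_matroid_def)

lemma mem_indep_partition_matroid:
  "S \<in> indep (partition_matroid G k cap) \<longleftrightarrow> S \<subseteq> G \<and> (\<forall>c. card {x \<in> S. k x = c} \<le> cap c)"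
  by (simp add: partition_matroid_def)

text \<open>For exchange, the larger set \<open>T\<close> has more elements than \<open>S\<close> in
  some class \<open>c\<close>. Adding one of them to \<open>S\<close> leaves the count in
  \<open>c\<close> at most that of \<open>T\<close>, and the other classes unchanged.\<close>

lemma matroid_partition_matroid:
  assumes "finite G"
  shows "matroid (partition_matroid G k cap)"
proof -
  let ?I = "indep (partition_matroid G k cap)"
  have "T \<in> ?I" if "S \<in> ?I" "T \<subseteq> S" for S T
  proof -
    have "finite S" using that assms by (auto simp: mem_indep_partition_matroid intro: finite_subset)
    then have "card {x \<in> T. k x = c} \<le> card {x \<in> S. k x = c}" for c
      using that(2) by (intro card_mono) auto
    then show ?thesis using that unfolding mem_indep_partition_matroid by (meson order_trans)
  qed
  moreover have "\<exists>x\<in>T - S. insert x S \<in> ?I" if "S \<in> ?I" "T \<in> ?I" "card S < card T" for S T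
  proof -
    note less = \<open>card S < card T\<close>
    have sub: "S \<subseteq> G" "T \<subseteq> G" using that by (auto simp: mem_indep_partition_matroid)
    then have fin: "finite S" "finite T" using assms finite_subset by blast+
    obtain c where c: "card {x \<in> S. k x = c} < card {x \<in> T. k x = c}"
    proof (rule ccontr)
      assume "\<not> thesis"
      with that have "card {x \<in> T. k x = c} \<le> card {x \<in> S. k x = c}" for c
        using not_less by blast
      then have "(\<Sum>c\<in>k ` G. card {x \<in> T. k x = c}) \<le> (\<Sum>c\<in>k ` G. card {x \<in> S. k x = c})"
        by (intro sum_mono) auto
      then show False
        using less sum_card_fibres[OF fin(1), of "k ` G" k] sum_card_fibres[OF fin(2), of "k ` G" k]
          sub assms by (simp add: image_mono)
    qed
    then have "\<not> {x \<in> T. k x = c} \<subseteq> {x \<in> S. k x = c}"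
      using fin card_mono[of "{x \<in> S. k x = c}" "{x \<in> T. k x = c}"] by auto
    then obtain x where x: "x \<in> T - S" "k x = c" by blast
    have "card {y \<in> insert x S. k y = d} \<le> cap d" for d
    proof (cases "d = c")
      case True
      have "{y \<in> insert x S. k y = c} = insert x {y \<in> S. k y = c}" using x by auto
      then have "card {y \<in> insert x S. k y = c} = Suc (card {y \<in> S. k y = c})"
        using x fin by simp
      also have "\<dots> \<le> card {y \<in> T. k y = c}" using c by simp
      also have "\<dots> \<le> cap c" using that(2) by (simp add: mem_indep_partition_matroid)
      finally show ?thesis using True by simp
    next
      case False
      then have "{y \<in> insert x S. k y = d} = {y \<in> S. k y = d}" using x by auto
      then show ?thesis using that(1) by (simp add: mem_indep_partition_matroid)
    qed
    then show ?thesis using x sub by (intro bexI[of _ x]) (auto simp: mem_indep_partition_matroid)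
  qed
  moreover have "?I \<subseteq> Pow G" "{} \<in> ?I" by (auto simp: partition_matroid_def)
  ultimately show ?thesis
    unfolding matroid_def ground_partition_matroid using assms by blast
qed

text \<open>The \<open>n\<close> elements are \<open>e 0, \<dots>, e (n - 1)\<close>; the two elements \<open>e (2 * v)\<close> and
  \<open>e (2 * v + 1)\<close> sit at the vertex \<open>v < 2 * m\<close>, the remaining \<open>n - 4 * m\<close> elements will be loops.\<close>

definition vertex_of :: "(nat \<Rightarrow> 'a) \<Rightarrow> 'a \<Rightarrow> nat" where
  "vertex_of e x = inv e x div 2"

definition class_size :: "nat \<Rightarrow> (nat \<Rightarrow> nat) \<Rightarrow> nat \<Rightarrow> nat" where
  "class_size m f c = card {v \<in> {..<2 * m}. f v = c}"

text \<open>Taking one element at every vertex meets all capacities \<open>class_size m f\<close>. A surplus at \<open>0\<close> for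
  \<open>f\<close> and at \<open>1\<close> for \<open>h\<close> can be used jointly iff a unit can be shifted along an alternating path.\<close>

definition surplus_matroid :: "(nat \<Rightarrow> 'a) \<Rightarrow> nat \<Rightarrow> nat \<Rightarrow> nat \<Rightarrow> (nat \<Rightarrow> nat) \<Rightarrow> 'a set_system" where
  "surplus_matroid e n m p f = partition_matroid (e ` {..<n}) (\<lambda>x. f (vertex_of e x))
     (\<lambda>c. class_size m f c + of_bool (c = f p))"

text \<open>The counterpart of \<open>surplus_matroid\<close> under complements in the
  \<open>4 * m\<close> elements at vertices: a class of \<open>s\<close> vertices carries
  \<open>2 * s\<close> elements, and removing \<open>s + 1\<close> of them leaves
  \<open>s - 1\<close>. This turns the intersection problem into a union problem.\<close>

definition deficit_matroid :: "(nat \<Rightarrow> 'a) \<Rightarrow> nat \<Rightarrow> nat \<Rightarrow> nat \<Rightarrow> (nat \<Rightarrow> nat) \<Rightarrow> 'a set_system" where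
  "deficit_matroid e n m p f = partition_matroid (e ` {..<n}) (\<lambda>x. f (vertex_of e x))
     (\<lambda>c. class_size m f c - of_bool (c = f p))"

lemma card_over_vertices_le:
  assumes "finite S" "finite A" "\<And>c. card {x \<in> S. f (vt x) = c} \<le> cap c"
  shows "card {x \<in> S. vt x \<in> A} \<le> (\<Sum>c\<in>f ` A. cap c)"
proof -
  let ?S = "{x \<in> S. vt x \<in> A}"
  have "card ?S = (\<Sum>c\<in>f ` A. card {x \<in> ?S. f (vt x) = c})"
    using assms by (intro sum_card_fibres[symmetric]) auto
  also have "\<dots> \<le> (\<Sum>c\<in>f ` A. cap c)"
  proof (rule sum_mono)
    fix c
    have "card {x \<in> ?S. f (vt x) = c} \<le> card {x \<in> S. f (vt x) = c}"
      using assms(1) by (intro card_mono) auto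
    then show "card {x \<in> ?S. f (vt x) = c} \<le> cap c" using assms(3) order_trans by blast
  qed
  finally show ?thesis .
qed

section \<open>Unions of classes as cuts, and the upper bounds for separated pairs\<close>

definition saturated :: "nat \<Rightarrow> (nat \<Rightarrow> nat) \<Rightarrow> nat set \<Rightarrow> bool" where
  "saturated m f A \<longleftrightarrow> A \<subseteq> {..<2 * m} \<and> (\<forall>u\<in>A. \<forall>v<2 * m. f u = f v \<longrightarrow> v \<in> A)"

lemma saturated_mem_image_iff:
  "saturated m f A \<Longrightarrow> v < 2 * m \<Longrightarrow> f v \<in> f ` A \<longleftrightarrow> v \<in> A"
  unfolding saturated_def by auto

lemma sum_class_size:
  assumes "saturated m f A"
  shows "(\<Sum>c\<in>f ` A. class_size m f c) = card A"
proof -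
  have fin: "finite A" using assms unfolding saturated_def by (meson finite_lessThan finite_subset)
  have "{v \<in> {..<2 * m}. f v = c} = {v \<in> A. f v = c}" if "c \<in> f ` A" for c
    using assms that unfolding saturated_def by auto
  then have "(\<Sum>c\<in>f ` A. class_size m f c) = (\<Sum>c\<in>f ` A. card {v \<in> A. f v = c})"
    by (simp add: class_size_def)
  also have "\<dots> = card A" using fin by (intro sum_card_fibres) auto
  finally show ?thesis .
qed

lemma sum_of_bool_eq:
  "finite C \<Longrightarrow> (\<Sum>c\<in>C. of_bool (c = d)) = (of_bool (d \<in> C) :: nat)"
  by (simp add: of_bool_def)

lemma surplus_matroid_bound:
  assumes "S \<in> indep (surplus_matroid e n m p f)" "saturated m f A" "p < 2 * m"
  shows "card {x \<in> S. vertex_of e x \<in> A} \<le> card A + of_bool (p \<in> A)"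
proof -
  have S: "S \<subseteq> e ` {..<n}"
    "\<And>c. card {x \<in> S. f (vertex_of e x) = c} \<le> class_size m f c + of_bool (c = f p)"
    using assms(1) by (auto simp: surplus_matroid_def mem_indep_partition_matroid)
  have fin: "finite A" using assms(2) unfolding saturated_def by (meson finite_lessThan finite_subset)
  have "finite S" using S(1) finite_subset by blast
  then have "card {x \<in> S. vertex_of e x \<in> A} \<le> (\<Sum>c\<in>f ` A. class_size m f c + of_bool (c = f p))"
    using fin S(2) by (rule card_over_vertices_le)
  also have "\<dots> = card A + of_bool (f p \<in> f ` A)"
    using fin assms(2) by (simp only: sum.distrib sum_class_size sum_of_bool_eq finite_imageI)
  finally show ?thesis using saturated_mem_image_iff[OF assms(2,3)] by simp
qed

lemma deficit_matroid_bound: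
  assumes "S \<in> indep (deficit_matroid e n m p f)" "saturated m f A" "p \<in> A"
  shows "card {x \<in> S. vertex_of e x \<in> A} < card A"
proof -
  have S: "S \<subseteq> e ` {..<n}"
    "\<And>c. card {x \<in> S. f (vertex_of e x) = c} \<le> class_size m f c - of_bool (c = f p)"
    using assms(1) by (auto simp: deficit_matroid_def mem_indep_partition_matroid)
  have fin: "finite A" using assms(2) unfolding saturated_def by (meson finite_lessThan finite_subset)
  have "p \<in> {v \<in> {..<2 * m}. f v = f p}" using assms(2,3) by (auto simp: saturated_def)
  \<comment> \<open>The class of \<open>p\<close> contains \<open>p\<close>, so the truncated
    subtraction really lowers its capacity.\<close>
  then have pos: "0 < class_size m f (f p)" unfolding class_size_def by (subst card_gt_0_iff) auto
  have "finite S" using S(1) finite_subset by blast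
  then have "card {x \<in> S. vertex_of e x \<in> A} \<le> (\<Sum>c\<in>f ` A. class_size m f c - of_bool (c = f p))"
    using fin S(2) by (rule card_over_vertices_le)
  also have "\<dots> < (\<Sum>c\<in>f ` A. class_size m f c)"
    using fin assms(3) pos by (intro sum_strict_mono_ex1) auto
  also have "\<dots> = card A" using assms(2) by (rule sum_class_size)
  finally show ?thesis .
qed

text \<open>A point beyond \<open>2 * m\<close> is fixed by \<open>f\<close> and is the image of no
  vertex, so its class has capacity 0 and the elements sitting there are loops.\<close>

lemma vertex_of_less:
  assumes "S \<in> indep (surplus_matroid e n m p f) \<or> S \<in> indep (deficit_matroid e n m p f)"
    and "x \<in> S" "f \<in> vertex_maps m" "p < 2 * m"
  shows "vertex_of e x < 2 * m"
proof (rule ccontr)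
  assume "\<not> vertex_of e x < 2 * m"
  let ?c = "vertex_of e x"
  have c: "f ?c = ?c" "f p \<noteq> ?c" "\<And>v. v < 2 * m \<Longrightarrow> f v \<noteq> ?c"
    using assms(3,4) \<open>\<not> ?c < 2 * m\<close> unfolding vertex_maps_def by force+
  have "class_size m f ?c = 0" using c(3) by (simp add: class_size_def)
  then have cap: "class_size m f ?c + of_bool (?c = f p) = 0" "class_size m f ?c - of_bool (?c = f p) = 0"
    using c(2) by auto
  have "card {y \<in> S. f (vertex_of e y) = ?c} \<le> 0" and "S \<subseteq> e ` {..<n}"
    using assms(1) unfolding surplus_matroid_def deficit_matroid_def mem_indep_partition_matroid
    using cap by (auto dest!: spec[of _ ?c])
  moreover have "finite S" using \<open>S \<subseteq> e ` {..<n}\<close> finite_subset by blast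
  ultimately show False using assms(2) c(1) by auto
qed

text \<open>The connected component of 0 is a union of classes of both maps, and so is its
  complement.\<close>

lemma separating_set:
  assumes "separated f h {0, 1}" "0 < m"
  obtains A where "saturated m f A" "saturated m h A" "saturated m f ({..<2 * m} - A)"
    "saturated m h ({..<2 * m} - A)" "0 \<in> A" "1 \<notin> A" "A \<subseteq> {..<2 * m}"
proof
  let ?A = "{v \<in> {..<2 * m}. (0, v) \<in> conn f h}"
  have "(0, u) \<in> conn f h \<longleftrightarrow> (0, v) \<in> conn f h" if "f u = f v \<or> h u = h v" for u v
    using connI[of f u v h, OF that] by (meson conn_sym conn_trans)
  then show "saturated m f ?A" "saturated m h ?A" "saturated m f ({..<2 * m} - ?A)"
    "saturated m h ({..<2 * m} - ?A)"
    by (auto simp: saturated_def)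
qed (use assms in \<open>auto simp: separated_def\<close>)

text \<open>Cut at the component \<open>A\<close> of 0. Inside \<open>A\<close> the second matroid
  has no surplus, since 1 lies outside; outside \<open>A\<close> the first has none, since 0 lies
  inside. This leaves at most one element per vertex on average on each side.\<close>

lemma common_independent_card_le:
  assumes S: "S \<in> indep (surplus_matroid e n m 0 f)" "S \<in> indep (surplus_matroid e n m 1 h)"
    and sep: "separated f h {0, 1}" and m: "0 < m" and f: "f \<in> vertex_maps m"
  shows "card S \<le> 2 * m"
proof -
  obtain A where A: "saturated m h A" "saturated m f ({..<2 * m} - A)"
    "0 \<in> A" "1 \<notin> A" "A \<subseteq> {..<2 * m}"
    by (rule separating_set[OF sep m])
  have "S = {x \<in> S. vertex_of e x \<in> A} \<union> {x \<in> S. vertex_of e x \<in> {..<2 * m} - A}"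
    using vertex_of_less[OF disjI1[OF S(1)]] f m by auto
  then have "card S = card ({x \<in> S. vertex_of e x \<in> A} \<union> {x \<in> S. vertex_of e x \<in> {..<2 * m} - A})"
    by (rule arg_cong)
  then have "card S \<le> card {x \<in> S. vertex_of e x \<in> A} + card {x \<in> S. vertex_of e x \<in> {..<2 * m} - A}"
    using card_Un_le[of "{x \<in> S. vertex_of e x \<in> A}" "{x \<in> S. vertex_of e x \<in> {..<2 * m} - A}"]
    by linarith
  also have "\<dots> \<le> card A + card ({..<2 * m} - A)"
    using surplus_matroid_bound[OF S(2) A(1)] surplus_matroid_bound[OF S(1) A(2)] A m
    by (intro add_mono) auto
  also have "\<dots> = 2 * m" using A(5) card_mono[OF _ A(5)]
    by (simp add: card_Diff_subset finite_subset[OF A(5)])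
  finally show ?thesis .
qed

lemma vertex_of_image [simp]: "inj e \<Longrightarrow> vertex_of e (e i) = i div 2"
  by (simp add: vertex_of_def)

lemma card_le_two_per_vertex:
  assumes "inj e" "finite A" "S \<subseteq> range e"
  shows "card {x \<in> S. vertex_of e x \<in> A} \<le> 2 * card A"
proof -
  have "{x \<in> S. vertex_of e x \<in> A} \<subseteq> (\<lambda>v. e (2 * v)) ` A \<union> (\<lambda>v. e (2 * v + 1)) ` A"
  proof
    fix x assume x: "x \<in> {x \<in> S. vertex_of e x \<in> A}"
    then obtain i where i: "x = e i" using assms(3) by auto
    define v where "v = i div 2"
    have "v \<in> A" using x i assms(1) by (simp add: v_def)
    moreover have "i = 2 * v \<or> i = 2 * v + 1" unfolding v_def by linarith
    ultimately show "x \<in> (\<lambda>v. e (2 * v)) ` A \<union> (\<lambda>v. e (2 * v + 1)) ` A" using i by blast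
  qed
  then have "card {x \<in> S. vertex_of e x \<in> A} \<le>
      card ((\<lambda>v. e (2 * v)) ` A \<union> (\<lambda>v. e (2 * v + 1)) ` A)"
    using assms(2) by (intro card_mono) auto
  also have "\<dots> \<le> card A + card A"
    by (rule order_trans[OF card_Un_le]) (intro add_mono card_image_le assms)
  finally show ?thesis by simp
qed

text \<open>On the component \<open>A\<close> of 0 the two sets contribute at most
  \<open>card A - 1\<close> and \<open>card A\<close>; elsewhere there are only two elements per
  vertex. So at least one of the \<open>4 * m\<close> elements is missed.\<close>

lemma union_card_less:
  assumes S: "S \<in> indep (deficit_matroid e n m 0 f)" "S' \<in> indep (surplus_matroid e n m 1 h)"
    and sep: "separated f h {0, 1}" and m: "0 < m" and f: "f \<in> vertex_maps m"
    and h: "h \<in> vertex_maps m" and e: "inj e"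
  shows "card (S \<union> S') < 4 * m"
proof -
  obtain A where A: "saturated m h A" "saturated m f A" "0 \<in> A" "1 \<notin> A" "A \<subseteq> {..<2 * m}"
    by (rule separating_set[OF sep m])
  let ?B = "{..<2 * m} - A"
  have sub: "S \<union> S' \<subseteq> e ` {..<n}"
    using S unfolding surplus_matroid_def deficit_matroid_def mem_indep_partition_matroid by blast
  have "S \<union> S' = {x \<in> S. vertex_of e x \<in> A} \<union> ({x \<in> S'. vertex_of e x \<in> A} \<union>
      {x \<in> S \<union> S'. vertex_of e x \<in> ?B})"
    using vertex_of_less[OF disjI2[OF S(1)]] vertex_of_less[OF disjI1[OF S(2)]] f h m by auto
  then have "card (S \<union> S') = card ({x \<in> S. vertex_of e x \<in> A} \<union> ({x \<in> S'. vertex_of e x \<in> A} \<union>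
      {x \<in> S \<union> S'. vertex_of e x \<in> ?B}))"
    by (rule arg_cong)
  then have "card (S \<union> S') \<le> card {x \<in> S. vertex_of e x \<in> A} + (card {x \<in> S'. vertex_of e x \<in> A} +
      card {x \<in> S \<union> S'. vertex_of e x \<in> ?B})"
    using card_Un_le[of "{x \<in> S. vertex_of e x \<in> A}" "{x \<in> S'. vertex_of e x \<in> A} \<union>
        {x \<in> S \<union> S'. vertex_of e x \<in> ?B}"]
      card_Un_le[of "{x \<in> S'. vertex_of e x \<in> A}" "{x \<in> S \<union> S'. vertex_of e x \<in> ?B}"]
    by linarith
  also have "\<dots> < card A + (card A + 2 * card ?B)"
  proof (intro add_less_le_mono add_mono)
    show "card {x \<in> S. vertex_of e x \<in> A} < card A" using S(1) A(2,3) by (rule deficit_matroid_bound)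
    show "card {x \<in> S'. vertex_of e x \<in> A} \<le> card A"
      using surplus_matroid_bound[OF S(2) A(1)] A m by simp
    show "card {x \<in> S \<union> S'. vertex_of e x \<in> ?B} \<le> 2 * card ?B"
      using e sub by (intro card_le_two_per_vertex) auto
  qed
  also have "\<dots> = 4 * m" using A(5) card_mono[OF _ A(5)]
    by (simp add: card_Diff_subset finite_subset[OF A(5)])
  finally show ?thesis .
qed

section \<open>Alternating paths for connected pairs\<close>

primrec level :: "('v \<Rightarrow> 'c) \<Rightarrow> ('v \<Rightarrow> 'd) \<Rightarrow> 'v \<Rightarrow> nat \<Rightarrow> 'v set" where
  "level f h s 0 = {x. f x = f s}"
| "level f h s (Suc n) = {x. \<exists>y. f x = f y \<and> h y \<in> h ` level f h s n}"

lemma level_Suc_mono: "level f h s n \<subseteq> level f h s (Suc n)"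
  by (induction n) auto

lemma level_saturated: "x \<in> level f h s n \<Longrightarrow> f x = f y \<Longrightarrow> y \<in> level f h s n"
  by (cases n) auto

text \<open>The levels are a breadth-first search from \<open>s\<close> in which a round is an
  \<open>h\<close>-step followed by an \<open>f\<close>-step. Along a path, an \<open>f\<close>-step
  stays inside its level and an \<open>h\<close>-step leads to the next one.\<close>

lemma conn_imp_level:
  assumes "(s, x) \<in> conn f h"
  shows "\<exists>n. x \<in> level f h s n"
  using assms unfolding conn_def
proof (induction rule: rtrancl_induct)
  case base
  have "s \<in> level f h s 0" by simp
  then show ?case by blast
next
  case (step y z)
  then obtain n where n: "y \<in> level f h s n" by blast
  from step.hyps(2) have "z \<in> level f h s (Suc n)"
  proof (cases "f y = f z")
    case True
    then have "z \<in> level f h s n" using n by (rule level_saturated[rotated])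
    then show ?thesis using level_Suc_mono by (rule rev_subsetD)
  next
    case False
    then have "h z = h y" using step.hyps(2) by simp
    then show ?thesis using n by auto
  qed
  then show ?case by blast
qed

text \<open>The sets \<open>X\<close> and \<open>Y\<close> are the vertices entered through \<open>f\<close>-classes and through \<open>h\<close>-classes
  on a shortest alternating path from \<open>s\<close> to \<open>x\<close>; taking levels into account
  guarantees that no vertex is used twice in the same role.\<close>

lemma level_imp_alternating_sets:
  assumes "x \<in> level f h s n"
  shows "\<exists>X Y. finite X \<and> finite Y \<and> X \<subseteq> level f h s n \<and>
    (\<forall>y\<in>Y. \<exists>k<n. h y \<in> h ` level f h s k) \<and> card X = Suc (card Y) \<and>
    (\<forall>c. card {v \<in> X. f v = c} = card {v \<in> Y. f v = c} + of_bool (c = f s)) \<and>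
    (\<forall>c. card {v \<in> X. h v = c} = card {v \<in> Y. h v = c} + of_bool (c = h x))"
  using assms
proof (induction n arbitrary: x)
  case 0
  have "{v. v = x \<and> P v} = (if P x then {x} else {})" for P by auto
  then show ?case using 0 by (intro exI[of _ "{x}"] exI[of _ "{}"]) auto
next
  case (Suc n)
  show ?case
  proof (cases "x \<in> level f h s n")
    case True
    obtain X Y where XY: "finite X" "finite Y" "X \<subseteq> level f h s n"
      "\<forall>y\<in>Y. \<exists>k<n. h y \<in> h ` level f h s k" "card X = Suc (card Y)"
      "\<forall>c. card {v \<in> X. f v = c} = card {v \<in> Y. f v = c} + of_bool (c = f s)"
      "\<forall>c. card {v \<in> X. h v = c} = card {v \<in> Y. h v = c} + of_bool (c = h x)"
      using Suc.IH[OF True] by blast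
    have "X \<subseteq> level f h s (Suc n)" using XY(3) level_Suc_mono by (rule subset_trans)
    moreover have "\<forall>y\<in>Y. \<exists>k<Suc n. h y \<in> h ` level f h s k" using XY(4) less_SucI by blast
    ultimately show ?thesis using XY by blast
  next
    case False
    obtain y x' where y: "f x = f y" "h y = h x'" "x' \<in> level f h s n"
      using Suc.prems by auto
    obtain X Y where XY: "finite X" "finite Y" "X \<subseteq> level f h s n"
      "\<forall>y\<in>Y. \<exists>k<n. h y \<in> h ` level f h s k" "card X = Suc (card Y)"
      "\<And>c. card {v \<in> X. f v = c} = card {v \<in> Y. f v = c} + of_bool (c = f s)"
      "\<And>c. card {v \<in> X. h v = c} = card {v \<in> Y. h v = c} + of_bool (c = h x')"
      using Suc.IH[OF y(3)] by blast
    have mono: "level f h s k \<subseteq> level f h s n" if "k \<le> n" for k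
      using that by (rule lift_Suc_mono_le[where f = "level f h s", rotated]) (rule level_Suc_mono)
    \<comment> \<open>A vertex of \<open>Y\<close> was entered by \<open>h\<close> from a level
      below \<open>n\<close>, so its \<open>f\<close>-class, which contains \<open>x\<close>, would
      already be reached by level \<open>n\<close>.\<close>
    have "y \<notin> Y"
    proof
      assume "y \<in> Y"
      then obtain k where "k < n" "h y \<in> h ` level f h s k" using XY(4) by blast
      then have "x \<in> level f h s (Suc k)" using y(1) by auto
      then show False using mono[of "Suc k"] \<open>k < n\<close> False by auto
    qed
    have "x \<notin> X" using XY(3) False by blast
    have ins: "card {v \<in> insert u Z. P v} = card {v \<in> Z. P v} + of_bool (P u)"
      if "finite Z" "u \<notin> Z" for u Z and P :: "'a \<Rightarrow> bool"
    proof -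
      have "{v \<in> insert u Z. P v} = (if P u then insert u {v \<in> Z. P v} else {v \<in> Z. P v})" by auto
      then show ?thesis using that by simp
    qed
    show ?thesis
    proof (intro exI conjI)
      show "\<forall>v\<in>insert y Y. \<exists>k<Suc n. h v \<in> h ` level f h s k"
      proof
        fix v assume "v \<in> insert y Y"
        then consider "v = y" | "v \<in> Y" by blast
        then show "\<exists>k<Suc n. h v \<in> h ` level f h s k"
        proof cases
          case 1
          then show ?thesis using y by (intro exI[of _ n]) auto
        next
          case 2
          then obtain k where "k < n" "h v \<in> h ` level f h s k" using XY(4) by blast
          then show ?thesis by (intro exI[of _ k]) auto
        qed
      qed
      show "insert x X \<subseteq> level f h s (Suc n)" 
        by (intro insert_subsetI Suc.prems subset_trans[OF XY(3) level_Suc_mono])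
      \<comment> \<open>The new vertices cancel for \<open>f\<close> because
        \<open>f x = f y\<close>. For \<open>h\<close>, the vertex \<open>y\<close> absorbs the old
        excess at \<open>h x'\<close>, and \<open>x\<close> creates the new one at
        \<open>h x\<close>.\<close>
      show "\<forall>c. card {v \<in> insert x X. f v = c} = card {v \<in> insert y Y. f v = c} + of_bool (c = f s)"
        using y by (simp only: ins[OF XY(1) \<open>x \<notin> X\<close>] ins[OF XY(2) \<open>y \<notin> Y\<close>] XY(6)) simp
      show "\<forall>c. card {v \<in> insert x X. h v = c} = card {v \<in> insert y Y. h v = c} + of_bool (c = h x)"
        using y by (simp only: ins[OF XY(1) \<open>x \<notin> X\<close>] ins[OF XY(2) \<open>y \<notin> Y\<close>] XY(7)) simp
    qed (use XY \<open>x \<notin> X\<close> \<open>y \<notin> Y\<close> in auto)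
  qed
qed

text \<open>At a vertex \<open>v\<close> it has 1 + [v in X] - [v in Y] elements: the first one is
  dropped on \<open>Y - X\<close>, the second one is added on \<open>X - Y\<close>.\<close>

definition selection :: "(nat \<Rightarrow> 'a) \<Rightarrow> nat \<Rightarrow> nat set \<Rightarrow> nat set \<Rightarrow> 'a set" where
  "selection e m X Y = (\<lambda>v. e (2 * v)) ` ({..<2 * m} - (Y - X)) \<union> (\<lambda>v. e (2 * v + 1)) ` (X - Y)"

lemma card_selection_class:
  assumes e: "inj e" and X: "X \<subseteq> {..<2 * m}" and Y: "Y \<subseteq> {..<2 * m}"
  shows "card {x \<in> selection e m X Y. P (vertex_of e x)} + card {v \<in> Y. P v} =
    card {v \<in> {..<2 * m}. P v} + card {v \<in> X. P v}"
proof -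
  have fin: "finite X" "finite Y" using X Y finite_subset by blast+
  have inj: "inj_on (\<lambda>v. e (2 * v)) Z" "inj_on (\<lambda>v. e (2 * v + 1)) Z" for Z
    by (rule inj_onI, drule injD[OF e], simp)+
  have "{x \<in> selection e m X Y. P (vertex_of e x)} =
      (\<lambda>v. e (2 * v)) ` {v \<in> {..<2 * m} - (Y - X). P v} \<union> (\<lambda>v. e (2 * v + 1)) ` {v \<in> X - Y. P v}"
    using e by (auto simp: selection_def)
  then have "card {x \<in> selection e m X Y. P (vertex_of e x)} =
      card ((\<lambda>v. e (2 * v)) ` {v \<in> {..<2 * m} - (Y - X). P v} \<union> (\<lambda>v. e (2 * v + 1)) ` {v \<in> X - Y. P v})"
    by (rule arg_cong)
  also have "\<dots> = card ((\<lambda>v. e (2 * v)) ` {v \<in> {..<2 * m} - (Y - X). P v}) +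
      card ((\<lambda>v. e (2 * v + 1)) ` {v \<in> X - Y. P v})"
  proof (intro card_Un_disjoint)
    have "2 * u \<noteq> 2 * v + 1" for u v :: nat by presburger
    then show "(\<lambda>v. e (2 * v)) ` {v \<in> {..<2 * m} - (Y - X). P v} \<inter>
        (\<lambda>v. e (2 * v + 1)) ` {v \<in> X - Y. P v} = {}"
      using e by (auto simp: inj_eq)
  qed (use fin in auto)
  also have "\<dots> = card {v \<in> {..<2 * m} - (Y - X). P v} + card {v \<in> X - Y. P v}"
    by (simp only: card_image[OF inj(1)] card_image[OF inj(2)])
  finally have sel: "card {x \<in> selection e m X Y. P (vertex_of e x)} =
      card {v \<in> {..<2 * m} - (Y - X). P v} + card {v \<in> X - Y. P v}" .
  have split: "card {v \<in> Z. P v} = card {v \<in> Z - D. P v} + card {v \<in> Z \<inter> D. P v}"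
    if "finite Z" for Z D :: "nat set"
    using that by (subst card_Un_disjoint[symmetric]) (auto intro: arg_cong[where f = card])
  have "{..<2 * m} \<inter> (Y - X) = Y - X" using Y by auto
  then show ?thesis
    using sel split[of "{..<2 * m}" "Y - X"] split[OF fin(1), of Y] split[OF fin(2), of X]
    by (simp add: Int_commute)
qed

lemma selection_subset:
  assumes "4 * m \<le> n" "X \<subseteq> {..<2 * m}"
  shows "selection e m X Y \<subseteq> e ` {..<n}"
proof -
  have "2 * v < n" "2 * v + 1 < n" if "v < 2 * m" for v using that assms(1) by linarith+
  then show ?thesis using assms(2) unfolding selection_def by auto
qed

text \<open>Shifting along an alternating path from 0 to 1 adds one unit to the
  \<open>f\<close>-class of 0 and to the \<open>h\<close>-class of 1 and keeps all other counts, so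
  both surpluses are used by the same set.\<close>

lemma connected_selection:
  assumes conn: "\<not> separated f h {0, 1}" and m: "0 < m" and f: "f \<in> vertex_maps m"
    and h: "h \<in> vertex_maps m" and e: "inj e" and n: "4 * m \<le> n"
  obtains S where "S \<in> indep (surplus_matroid e n m 0 f)" "S \<in> indep (surplus_matroid e n m 1 h)"
    "card S = 2 * m + 1" "e ` {..<4 * m} - S \<in> indep (deficit_matroid e n m 0 f)"
    "S \<subseteq> e ` {..<4 * m}"
proof -
  have "(0, 1) \<in> conn f h" using conn conn_sym unfolding separated_def by force
  then obtain l where l: "1 \<in> level f h 0 l" using conn_imp_level by metis
  obtain X Y where XY: "X \<subseteq> level f h 0 l" "\<forall>y\<in>Y. \<exists>k<l. h y \<in> h ` level f h 0 k"
      "card X = Suc (card Y)"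
      "\<And>c. card {v \<in> X. f v = c} = card {v \<in> Y. f v = c} + of_bool (c = f 0)"
      "\<And>c. card {v \<in> X. h v = c} = card {v \<in> Y. h v = c} + of_bool (c = h 1)"
    using level_imp_alternating_sets[OF l] by blast
  \<comment> \<open>Vertices and padding points never share a class, so the search from 0 stays
    among the vertices.\<close>
  have less_iff: "g v < 2 * m \<longleftrightarrow> v < 2 * m" if "g \<in> vertex_maps m" for g v
    using that by (cases "v < 2 * m") (auto simp: vertex_maps_def)
  have level: "level f h 0 k \<subseteq> {..<2 * m}" for k
  proof (induction k)
    case 0
    show ?case
    proof
      fix x assume "x \<in> level f h 0 0"
      then have "f x = f 0" by simp
      then show "x \<in> {..<2 * m}" using less_iff[OF f, of x] less_iff[OF f, of 0] m by simp
    qed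
  next
    case (Suc k)
    show ?case
    proof
      fix x assume "x \<in> level f h 0 (Suc k)"
      then obtain y z where "f x = f y" "h y = h z" "z \<in> level f h 0 k" by auto
      moreover from this(3) have "z < 2 * m" using Suc by blast
      ultimately show "x \<in> {..<2 * m}"
        using less_iff[OF f, of x] less_iff[OF f, of y] less_iff[OF h, of y] less_iff[OF h, of z] by simp
    qed
  qed
  have X: "X \<subseteq> {..<2 * m}" using XY(1) level by blast
  have Y: "Y \<subseteq> {..<2 * m}"
  proof
    fix y assume "y \<in> Y"
    then obtain k z where "h y = h z" "z \<in> level f h 0 k" using XY(2) by blast
    moreover from this(2) have "z < 2 * m" using level by blast
    ultimately show "y \<in> {..<2 * m}" using less_iff[OF h, of y] less_iff[OF h, of z] by simp
  qed
  let ?S = "selection e m X Y"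
  have cf: "card {x \<in> ?S. f (vertex_of e x) = c} = class_size m f c + of_bool (c = f 0)" for c
    using card_selection_class[OF e X Y, of "\<lambda>v. f v = c"] XY(4)[of c] by (simp add: class_size_def)
  have ch: "card {x \<in> ?S. h (vertex_of e x) = c} = class_size m h c + of_bool (c = h 1)" for c
    using card_selection_class[OF e X Y, of "\<lambda>v. h v = c"] XY(5)[of c] by (simp add: class_size_def)
  let ?U = "e ` {..<4 * m}"
  \<comment> \<open>All elements at vertices are a selection too, so the counting lemma also gives
    the class counts of \<open>?U\<close>.\<close>
  have U: "selection e m {..<2 * m} {} = ?U"
  proof -
    have "i \<in> (*) 2 ` {..<2 * m} \<union> (\<lambda>v. 2 * v + 1) ` {..<2 * m}" if "i < 4 * m" for i
    proof -
      define v where "v = i div 2"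
      have "i = 2 * v \<or> i = 2 * v + 1" "v < 2 * m" using that unfolding v_def by linarith+
      then show ?thesis by blast
    qed
    then have "{..<4 * m} = (*) 2 ` {..<2 * m} \<union> (\<lambda>v. 2 * v + 1) ` {..<2 * m}" by auto
    then show ?thesis by (simp add: selection_def image_Un image_image)
  qed
  have SU: "?S \<subseteq> ?U" using selection_subset[of m "4 * m" X] X by simp
  have cU: "card {x \<in> ?U. f (vertex_of e x) = c} = 2 * class_size m f c" for c
    using card_selection_class[OF e, of "{..<2 * m}" m "{}" "\<lambda>v. f v = c"]
    by (simp add: U class_size_def)
  have "card {x \<in> ?U - ?S. f (vertex_of e x) = c} = class_size m f c - of_bool (c = f 0)" for c
  proof -
    have "{x \<in> ?U - ?S. f (vertex_of e x) = c} =
        {x \<in> ?U. f (vertex_of e x) = c} - {x \<in> ?S. f (vertex_of e x) = c}" by auto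
    moreover have "finite {x \<in> ?S. f (vertex_of e x) = c}" using SU finite_subset by fastforce
    ultimately have "card {x \<in> ?U - ?S. f (vertex_of e x) = c} =
        card {x \<in> ?U. f (vertex_of e x) = c} - card {x \<in> ?S. f (vertex_of e x) = c}"
      using SU by (simp add: card_Diff_subset Collect_mono_iff subset_iff)
    then show ?thesis by (simp add: cf cU)
  qed
  moreover have "?U - ?S \<subseteq> e ` {..<n}" using n by auto
  moreover have "card ?S = 2 * m + 1"
    using card_selection_class[OF e X Y, of "\<lambda>_. True"] XY(3) by simp
  ultimately show ?thesis using that[of ?S] cf ch selection_subset[OF n X, of e Y] SU
    by (auto simp: surplus_matroid_def deficit_matroid_def mem_indep_partition_matroid)
qed

section \<open>From the rank bound to query bounds\<close>

section \<open>The lower bounds\<close>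

text \<open>Transcripts of length at most \<open>q\<close> colour the pairs \<open>(f, h)\<close>.
  The colour classes are rectangles by exchange, and the output, hence connectivity, is constant on
  them. There are \<open>2 ^ Suc q - 1\<close> such transcripts.\<close>

lemma card_retractions_le_transcripts:
  assumes enc: "bit_transcript orc A enc" and m: "2 \<le> m"
    and mix: "\<And>f h f' h'. f \<in> vertex_maps m \<Longrightarrow> h \<in> vertex_maps m \<Longrightarrow> f' \<in> vertex_maps m \<Longrightarrow>
      h' \<in> vertex_maps m \<Longrightarrow> mixture (Ms f h) (Ms f' h') (Ms f h')"
    and decide: "\<And>f h. f \<in> vertex_maps m \<Longrightarrow> h \<in> vertex_maps m \<Longrightarrow>
      separated f h {0, 1} \<longleftrightarrow> P (output_on orc A (Ms f h))"
    and bound: "\<And>f h. f \<in> vertex_maps m \<Longrightarrow> h \<in> vertex_maps m \<Longrightarrow> queries_on orc A (Ms f h) \<le> q"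
  shows "m ^ m < 2 ^ Suc q"
proof -
  let ?T = "{bs :: bool list. set bs \<subseteq> UNIV \<and> length bs \<le> q}"
  have len: "length (enc Ns) = queries_on orc A Ns" for Ns
    using enc unfolding bit_transcript_def by blast
  have paste: "enc Ns'' = enc Ns \<and> output_on orc A Ns'' = output_on orc A Ns"
    if "mixture Ns Ns' Ns''" "enc Ns = enc Ns'" for Ns Ns' Ns''
    using enc that unfolding bit_transcript_def by blast
  have "card (retractions m) \<le> card ?T"
  proof (rule rectangle_partition_card_ge[where F = "vertex_maps m" and \<tau> = "\<lambda>f h. enc (Ms f h)"
        and N = "\<lambda>f h. of_bool (separated f h {0, 1})"])
    show "finite ?T" by (rule finite_lists_length_le) simp
    show "finite (retractions m)" by (rule finite_retractions)
    fix f h assume "f \<in> vertex_maps m" "h \<in> retractions m"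
    then have fh: "f \<in> vertex_maps m" "h \<in> vertex_maps m" using retractions_subset by blast+
    then show "enc (Ms f h) \<in> ?T" using bound len by simp
    fix f' h' assume "f' \<in> vertex_maps m" "h' \<in> retractions m" and eq: "enc (Ms f h) = enc (Ms f' h')"
    then have fh': "f' \<in> vertex_maps m" "h' \<in> vertex_maps m" using retractions_subset by blast+
    show "enc (Ms f h') = enc (Ms f h)" using paste[OF mix[OF fh fh'] eq] by simp
    \<comment> \<open>Taking every matroid from the second instance is a mixture as well, so equal
      transcripts imply equal outputs.\<close>
    have "mixture (Ms f h) (Ms f' h') (Ms f' h')"
      using mix[OF fh fh'] by (simp add: mixture_def)
    from paste[OF this eq] show "of_bool (separated f h {0, 1}) = (of_bool (separated f' h' {0, 1}) :: real)"
      using decide[OF fh] decide[OF fh'] by simp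
  next
    fix w :: "(nat \<Rightarrow> nat) \<Rightarrow> real"
    assume "\<And>f. f \<in> vertex_maps m \<Longrightarrow>
      (\<Sum>h\<in>retractions m. w h * of_bool (separated f h {0, 1})) = 0"
    then show "\<forall>h\<in>retractions m. w h = 0" by (rule separated_columns_independent[OF m])
  qed
  also have "card ?T = (\<Sum>i\<le>q. 2 ^ i)" by (subst card_lists_length_le) (simp_all add: card_UNIV_bool)
  also have "\<dots> < 2 ^ Suc q"
    using sum_power2[of "Suc q"] by (simp add: atLeast0LessThan lessThan_Suc_atMost)
  finally show ?thesis by (simp add: card_retractions)
qed

lemma requires_queries_family:
  assumes enc: "\<And>A. \<exists>enc. bit_transcript orc A enc" and m: "2 \<le> m"
    and large: "2 ^ Suc (nat \<lfloor>b\<rfloor>) < m ^ m"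
    and inst: "\<And>f h. f \<in> vertex_maps m \<Longrightarrow> h \<in> vertex_maps m \<Longrightarrow>
      inst (Ms f h) \<and> max_ground_size (Ms f h) = n"
    and mix: "\<And>f h f' h'. f \<in> vertex_maps m \<Longrightarrow> h \<in> vertex_maps m \<Longrightarrow> f' \<in> vertex_maps m \<Longrightarrow>
      h' \<in> vertex_maps m \<Longrightarrow> mixture (Ms f h) (Ms f' h') (Ms f h')"
    and decide: "\<And>f h S. f \<in> vertex_maps m \<Longrightarrow> h \<in> vertex_maps m \<Longrightarrow>
      max_size_in (feasible (Ms f h)) S \<Longrightarrow> separated f h {0, 1} \<longleftrightarrow> card S < thr"
  shows "requires_queries orc inst feasible n b"
  unfolding requires_queries_def
proof (intro allI impI, rule ccontr)
  fix A
  assume solves: "solves orc inst feasible A"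
    and none: "\<not> (\<exists>Ms. inst Ms \<and> max_ground_size Ms = n \<and> b \<le> real (queries_on orc A Ms))"
  obtain enc where "bit_transcript orc A enc" using enc by blast
  then have "m ^ m < 2 ^ Suc (nat \<lfloor>b\<rfloor>)" using m mix
  proof (rule card_retractions_le_transcripts)
    fix f h assume fh: "f \<in> vertex_maps m" "h \<in> vertex_maps m"
    have "max_size_in (feasible (Ms f h)) (output_on orc A (Ms f h))"
      using solves inst[OF fh] unfolding solves_def by blast
    then show "separated f h {0, 1} \<longleftrightarrow> card (output_on orc A (Ms f h)) < thr"
      by (rule decide[OF fh])
    have "real (queries_on orc A (Ms f h)) < b" using none inst[OF fh] not_le by blast
    then show "queries_on orc A (Ms f h) \<le> nat \<lfloor>b\<rfloor>" by linarith
  qed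
  then show False using large by simp
qed

lemma matroid_surplus_matroid: "matroid (surplus_matroid e n m p f)"
  and matroid_deficit_matroid: "matroid (deficit_matroid e n m p f)"
  by (simp_all add: surplus_matroid_def deficit_matroid_def matroid_partition_matroid)

lemma ground_surplus_matroid: "ground (surplus_matroid e n m p f) = e ` {..<n}"
  and ground_deficit_matroid: "ground (deficit_matroid e n m p f) = e ` {..<n}"
  by (simp_all add: surplus_matroid_def deficit_matroid_def)

lemma max_ground_size_eq:
  assumes "inj e" "Ms \<noteq> []" "fst ` set Ms \<subseteq> {e ` {..<n}}"
  shows "max_ground_size Ms = n"
proof -
  have "fst ` set Ms = {e ` {..<n}}" using assms(2,3) by (simp add: subset_singleton_iff)
  then have "(\<lambda>M. card (ground M)) ` set Ms = {card (e ` {..<n})}"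
    unfolding image_image[of card fst, symmetric] by simp
  also have "card (e ` {..<n}) = n" using assms(1) by (simp add: card_image inj_on_subset)
  finally have "(\<lambda>M. card (ground M)) ` set Ms = {n}" .
  then show ?thesis by (simp add: max_ground_size_def)
qed

lemma mixture_two:
  assumes "matroid M1" "matroid M2" "matroid M1'" "matroid M2'" "Ball (set R) matroid"
    and "ground M1' = ground M1" "ground M2' = ground M2"
  shows "mixture (M1 # M2 # R) (M1' # M2' # R) (M1 # M2' # R)"
  using assms by (auto simp: mixture_def nth_Cons split: nat.split)

text \<open>The optimum is at least \<open>2 * m + 1\<close> for connected pairs and at most
  \<open>2 * m\<close> for separated ones.\<close>

lemma requires_queries_intersection:
  fixes e :: "nat \<Rightarrow> 'a"
  assumes enc: "\<And>A. \<exists>enc. bit_transcript orc A enc" and m: "2 \<le> m" and n: "4 * m \<le> n"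
    and large: "2 ^ Suc (nat \<lfloor>b\<rfloor>) < m ^ m" and e: "inj e"
  shows "requires_queries orc (intersection_instance :: 'a set_system list \<Rightarrow> bool)
    common_independent_sets n b"
  using enc m large
proof (rule requires_queries_family[where
      Ms = "\<lambda>f h. [surplus_matroid e n m 0 f, surplus_matroid e n m 1 h]" and thr = "2 * m + 1"])
  fix f h assume fh: "f \<in> vertex_maps m" "h \<in> vertex_maps m"
  show "intersection_instance [surplus_matroid e n m 0 f, surplus_matroid e n m 1 h] \<and>
      max_ground_size [surplus_matroid e n m 0 f, surplus_matroid e n m 1 h] = n"
    using max_ground_size_eq[OF e, of "[surplus_matroid e n m 0 f, surplus_matroid e n m 1 h]" n]
    by (simp add: intersection_instance_def matroid_surplus_matroid ground_surplus_matroid)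
  show "mixture [surplus_matroid e n m 0 f, surplus_matroid e n m 1 h]
      [surplus_matroid e n m 0 f', surplus_matroid e n m 1 h']
      [surplus_matroid e n m 0 f, surplus_matroid e n m 1 h']" for f' h'
    by (rule mixture_two) (simp_all add: matroid_surplus_matroid ground_surplus_matroid)
  fix S
  assume S: "max_size_in (common_independent_sets
      [surplus_matroid e n m 0 f, surplus_matroid e n m 1 h]) S"
  show "separated f h {0, 1} \<longleftrightarrow> card S < 2 * m + 1"
  proof
    assume "separated f h {0, 1}"
    moreover have "S \<in> indep (surplus_matroid e n m 0 f)" "S \<in> indep (surplus_matroid e n m 1 h)"
      using S by (auto simp: max_size_in_def common_independent_sets_def)
    ultimately have "card S \<le> 2 * m" using m fh by (intro common_independent_card_le[of S e n m f h]) auto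
    then show "card S < 2 * m + 1" by simp
  next
    assume less: "card S < 2 * m + 1"
    show "separated f h {0, 1}"
    proof (rule ccontr)
      assume "\<not> separated f h {0, 1}"
      then obtain S' where "S' \<in> indep (surplus_matroid e n m 0 f)"
        "S' \<in> indep (surplus_matroid e n m 1 h)" "card S' = 2 * m + 1"
        using connected_selection[of f h m e n] m fh e n by auto
      then show False using S less by (auto simp: max_size_in_def common_independent_sets_def)
    qed
  qed
qed

text \<open>The first two matroids can cover all \<open>4 * m\<close> elements at vertices for
  connected pairs but not for separated ones. Any \<open>k\<close> is reached by padding with
  rank-zero matroids.\<close>

lemma requires_queries_union:
  fixes e :: "nat \<Rightarrow> 'a"
  assumes enc: "\<And>A. \<exists>enc. bit_transcript orc A enc" and m: "2 \<le> m" and n: "4 * m \<le> n"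
    and large: "2 ^ Suc (nat \<lfloor>b\<rfloor>) < m ^ m" and e: "inj e" and k: "2 \<le> k"
  shows "requires_queries orc (union_instance k :: 'a set_system list \<Rightarrow> bool)
    unions_of_independent_sets n b"
proof -
  define Z :: "'a set_system" where "Z = partition_matroid (e ` {..<n}) (\<lambda>_. ()) (\<lambda>_. 0)"
  have Z: "matroid Z" "ground Z = e ` {..<n}" by (simp_all add: Z_def matroid_partition_matroid)
  have Z_indep: "T = {}" if "T \<in> indep Z" for T
  proof -
    have "T \<subseteq> e ` {..<n}" "card T = 0" using that by (auto simp: Z_def mem_indep_partition_matroid)
    then show ?thesis using finite_subset[of T] by auto
  qed
  have Z_empty: "{} \<in> indep Z" using Z(1) by (simp add: matroid_def)
  define Ms where "Ms f h = deficit_matroid e n m 0 f # surplus_matroid e n m 1 h # replicate (k - 2) Z" for f h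
  have len: "length (Ms f h) = k" for f h using k by (simp add: Ms_def)
  have nth: "Ms f h ! 0 = deficit_matroid e n m 0 f" "Ms f h ! 1 = surplus_matroid e n m 1 h"
    "2 \<le> j \<Longrightarrow> j < k \<Longrightarrow> Ms f h ! j = Z" for f h j
    by (auto simp: Ms_def nth_Cons split: nat.split)
  show ?thesis
    using enc m large
  proof (rule requires_queries_family[where Ms = Ms and thr = "4 * m"])
    fix f h assume fh: "f \<in> vertex_maps m" "h \<in> vertex_maps m"
    have "max_ground_size (Ms f h) = n"
      using e by (rule max_ground_size_eq)
        (simp_all add: Ms_def ground_surplus_matroid ground_deficit_matroid Z set_replicate_conv_if)
    moreover have "union_instance k (Ms f h)"
      unfolding union_instance_def
      using len by (auto simp: Ms_def matroid_surplus_matroid matroid_deficit_matroid Z)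
    ultimately show "union_instance k (Ms f h) \<and> max_ground_size (Ms f h) = n" by blast
    show "mixture (Ms f h) (Ms f' h') (Ms f h')" for f' h'
      unfolding Ms_def by (rule mixture_two) (simp_all add: matroid_surplus_matroid
          matroid_deficit_matroid ground_surplus_matroid ground_deficit_matroid Z)
    fix S
    assume S: "max_size_in (unions_of_independent_sets (Ms f h)) S"
    show "separated f h {0, 1} \<longleftrightarrow> card S < 4 * m"
    proof
      assume sep: "separated f h {0, 1}"
      obtain T where T: "S = (\<Union>j<k. T j)" "\<And>j. j < k \<Longrightarrow> T j \<in> indep (Ms f h ! j)"
        using S by (auto simp: max_size_in_def unions_of_independent_sets_def len)
      have T01: "T 0 \<in> indep (deficit_matroid e n m 0 f)" "T 1 \<in> indep (surplus_matroid e n m 1 h)"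
        using T(2)[of 0] T(2)[of 1] k nth by auto
      have "T j \<subseteq> T 0 \<union> T 1" if "j < k" for j
      proof (cases "2 \<le> j")
        case True
        then show ?thesis using Z_indep[of "T j"] T(2)[OF that] nth(3) that by simp
      next
        case False
        then have "j = 0 \<or> j = 1" by linarith
        then show ?thesis by blast
      qed
      moreover have "T 0 \<subseteq> S" "T 1 \<subseteq> S" using T(1) k by auto
      ultimately have "S = T 0 \<union> T 1" using T(1) by blast
      then show "card S < 4 * m" using union_card_less[OF T01 sep] m fh e by simp
    next
      assume less: "card S < 4 * m"
      show "separated f h {0, 1}"
      proof (rule ccontr)
        assume "\<not> separated f h {0, 1}"
        then obtain S' where S': "S' \<in> indep (surplus_matroid e n m 1 h)"
          "e ` {..<4 * m} - S' \<in> indep (deficit_matroid e n m 0 f)" "S' \<subseteq> e ` {..<4 * m}"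
          using connected_selection[of f h m e n] m fh e n by auto
        define T where "T j = (if j = 0 then e ` {..<4 * m} - S' else if j = 1 then S' else {})" for j :: nat
        have "T j \<in> indep (Ms f h ! j)" if "j < k" for j
        proof -
          consider "j = 0" | "j = 1" | "2 \<le> j" by linarith
          then show ?thesis
            by cases (use S' nth that Z_empty in \<open>auto simp: T_def\<close>)
        qed
        then have "(\<Union>j<k. T j) \<in> unions_of_independent_sets (Ms f h)"
          unfolding unions_of_independent_sets_def len by blast
        moreover have "(\<Union>j<k. T j) = e ` {..<4 * m}"
        proof
          show "(\<Union>j<k. T j) \<subseteq> e ` {..<4 * m}" using S'(3) by (auto simp: T_def split: if_splits)
          have "T 0 \<union> T 1 = e ` {..<4 * m}" using S'(3) by (auto simp: T_def)
          then show "e ` {..<4 * m} \<subseteq> (\<Union>j<k. T j)" using k by fastforce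
        qed
        moreover have "card (e ` {..<4 * m}) = 4 * m" using e by (simp add: card_image inj_on_subset)
        ultimately show False using S less unfolding max_size_in_def by fastforce
      qed
    qed
  qed
qed

text \<open>With \<open>m = n div 4\<close>, the bound is \<open>m ^ m = exp (m * ln m)\<close>,
  where \<open>m\<close> is at least \<open>n / 8\<close>, while the power of 2 is estimated by a
  power of \<open>e\<close>. The constant 1/64 leaves ample room below 1/8.\<close>

lemma eventually_large:
  "\<forall>\<^sub>F n in sequentially. 2 \<le> n div 4 \<and>
     2 ^ Suc (nat \<lfloor>1 / 64 * (real n * ln (real n))\<rfloor>) < (n div 4) ^ (n div 4)"
proof -
  have "\<forall>\<^sub>F n in sequentially. 1 / 64 * (real n * ln (real n)) + 1 < real n / 8 * ln (real n / 8)"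
    by real_asymp
  then show ?thesis using eventually_ge_at_top[of 16]
  proof eventually_elim
    case (elim n)
    define m where "m = n div 4"
    define b where "b = 1 / 64 * (real n * ln (real n))"
    have m: "real n / 8 \<le> real m" "2 \<le> m" using elim(2) unfolding m_def by linarith+
    have "0 \<le> b" using elim(2) by (simp add: b_def)
    have "real (2 ^ Suc (nat \<lfloor>b\<rfloor>)) = 2 powr (real (nat \<lfloor>b\<rfloor>) + 1)"
      by (simp add: powr_add powr_realpow)
    also have "\<dots> \<le> 2 powr (b + 1)" using \<open>0 \<le> b\<close> by (intro powr_mono) auto
    also have "\<dots> \<le> exp 1 powr (b + 1)" using \<open>0 \<le> b\<close> exp_ge_add_one_self[of 1]
      by (intro powr_mono2) auto
    also have "\<dots> = exp (b + 1)" by (simp add: powr_def)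
    also have "\<dots> < exp (real n / 8 * ln (real n / 8))" using elim(1) by (simp add: b_def)
    also have "\<dots> \<le> exp (real m * ln (real m))"
      using m elim(2) by (simp only: exp_le_cancel_iff) (intro mult_mono, auto)
    also have "\<dots> = real (m ^ m)" using m(2) by (simp add: exp_of_nat_mult)
    finally have "2 ^ Suc (nat \<lfloor>b\<rfloor>) < m ^ m" unfolding of_nat_less_iff .
    then show ?case using m(2) by (simp add: m_def b_def)
  qed
qed

lemma eventually_requires_queries_union:
  fixes e :: "nat \<Rightarrow> 'a"
  assumes enc: "\<And>A. \<exists>enc. bit_transcript orc A enc" and e: "inj e"
  shows "\<exists>c>0. \<forall>\<^sub>F n in sequentially. \<forall>k\<ge>2.
    requires_queries orc (union_instance k :: 'a set_system list \<Rightarrow> bool)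
      unions_of_independent_sets n (c * (real n * ln (real n)))"
proof (intro exI conjI)
  show "\<forall>\<^sub>F n in sequentially. \<forall>k\<ge>2.
      requires_queries orc (union_instance k :: 'a set_system list \<Rightarrow> bool)
        unions_of_independent_sets n (1 / 64 * (real n * ln (real n)))"
    using eventually_large
  proof eventually_elim
    case (elim n)
    then show ?case
      using requires_queries_union[OF enc, of "n div 4" n, OF _ _ _ e] by auto
  qed
qed simp

lemma eventually_requires_queries_intersection:
  fixes e :: "nat \<Rightarrow> 'a"
  assumes enc: "\<And>A. \<exists>enc. bit_transcript orc A enc" and e: "inj e"
  shows "\<exists>c>0. \<forall>\<^sub>F n in sequentially.
    requires_queries orc (intersection_instance :: 'a set_system list \<Rightarrow> bool)
      common_independent_sets n (c * (real n * ln (real n)))"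
proof (intro exI conjI)
  show "\<forall>\<^sub>F n in sequentially.
      requires_queries orc (intersection_instance :: 'a set_system list \<Rightarrow> bool)
        common_independent_sets n (1 / 64 * (real n * ln (real n)))"
    using eventually_large
  proof eventually_elim
    case (elim n)
    then show ?case
      using requires_queries_intersection[OF enc, of "n div 4" n, OF _ _ _ e] by auto
  qed
qed simp

theorem theorem1p5:
  assumes "infinite (UNIV :: 'a set)"
  shows
    "(\<exists>c>0. \<forall>\<^sub>F n in sequentially. \<forall>k\<ge>2.
        requires_queries dynamic_rank_oracle
          (union_instance k :: 'a set_system list \<Rightarrow> bool) unions_of_independent_sets
          n (c * (real n * ln (real n)))) \<and>
     (\<exists>c>0. \<forall>\<^sub>F n in sequentially.
        requires_queries dynamic_rank_oracle
          (intersection_instance :: 'a set_system list \<Rightarrow> bool) common_independent_sets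
          n (c * (real n * ln (real n)))) \<and>
     (\<exists>c>0. \<forall>\<^sub>F n in sequentially. \<forall>k\<ge>2.
        requires_queries independence_oracle
          (union_instance k :: 'a set_system list \<Rightarrow> bool) unions_of_independent_sets
          n (c * (real n * ln (real n)))) \<and>
     (\<exists>c>0. \<forall>\<^sub>F n in sequentially.
        requires_queries independence_oracle
          (intersection_instance :: 'a set_system list \<Rightarrow> bool) common_independent_sets
          n (c * (real n * ln (real n))))"
proof -
  obtain e :: "nat \<Rightarrow> 'a" where e: "inj e" using infinite_countable_subset[OF assms] by auto
  show ?thesis
    using eventually_requires_queries_union[OF dynamic_rank_oracle_transcript e]
      eventually_requires_queries_intersection[OF dynamic_rank_oracle_transcript e]
      eventually_requires_queries_union[OF independence_oracle_transcript e]
      eventually_requires_queries_intersection[OF independence_oracle_transcript e]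
    by blast
qed

end
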